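(* Let $b\ge 2$, $s\ge 1$, $n\ge 1$ be integers. There is a constant $C_{b,s,n}$ depending only on $b,s,n$ such that for every $n$-smooth function $f\colon[0,1)^s\to\mathbb{R}$ and every subgroup $P\subset \mathbb{Z}_b^{s\times n}$, $$\mathrm{Err}(f;P,n):=|I(f)-I_{P,n}(f)|\le C_{b,s,n}\,\|f\|_n\cdot \mathrm{WF}(P).$$
   Context: $\mathbb{Z}_b=\mathbb{Z}/b\mathbb{Z}$ is identified with $\{0,\dots,b-1\}$; $\mathbb{Z}_b^{s\times n}$ is the additive group of $s\times n$ matrices over $\mathbb{Z}_b$ and $O$ is the zero matrix. Discretization. For $B=(b_{i,j})\in\mathbb{Z}_b^{s\times n}$ let $x_B^i=\sum_{j=1}^n b_{i,j}b^{-j}$ and $\mathbf{I}_B=\prod_{i=1}^s[x_B^i,x_B^i+b^{-n})\subset[0,1)^s$. For integrable $f\colon[0,1)^s\to\mathbb{R}$ put $f_n(B)=\frac{1}{\mathrm{Vol}(\mathbf{I}_B)}\int_{\mathbf{I}_B}f(\boldsymbol{x})\,d\boldsymbol{x}$, $I(f)=\int_{[0,1)^s}f(\boldsymbol{x})\,d\boldsymbol{x}$ and $I_{P,n}(f)=\frac1{|P|}\sum_{B\in P}f_n(B)$. WAFOM. Put $\omega_b=\exp(2\pi\sqrt{-1}/b)$ and, for $A=(a_{i,j}),B=(b_{i,j})\in\mathbb{Z}_b^{s\times n}$, $A\bullet B=\prod_{i,j}\omega_b^{a_{i,j}b_{i,j}}$ (so that $\mathbb{Z}_b^{s\times n}$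 is identified with its own character group). For a subgroup $P$, $P^\perp=\{A\in\mathbb{Z}_b^{s\times n}: A\bullet B=1\text{ for all }B\in P\}$. The Dick weight is $\mu(A)=\sum_{i,j}j\,\delta(a_{i,j})$ with $\delta(0)=0$ and $\delta(h)=1$ for $h\ne0$. The Walsh figure of merit is $\mathrm{WF}(P)=\sum_{A\in P^\perp\setminus\{O\}}b^{-\mu(A)}$. Smoothness and norm. $f$ is $n$-smooth if all (weak) mixed partial derivatives $f^{(\tau_1,\dots,\tau_s)}$ with $0\le\tau_i\le n$ for each $i$ are square integrable. The norm is the Sobolev norm $$\|f\|_n^2=\sum_{u\subseteq\{1,\dots,s\}}\ \sum_{\tau\in\{0,\dots,n-1\}^{\{1,\dots,s\}\setminus u}}\int_{[0,1]^{|u|}}\Bigl|\int_{[0,1]^{s-|u|}}f^{(\tau,n_u)}(\boldsymbol{x})\,d\boldsymbol{x}_{\{1,\dots,s\}\setminus u}\Bigr|^2d\boldsymbol{x}_u,$$ where $f^{(\tau,n_u)}$ is the mixed derivative of order $n$ in each variable $x_i$ with $i\in u$ and of order $\tau_i$ in each variable $x_i$ with $i\notin u$. *)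

theory Defs
  imports "HOL-Analysis.Analysis" "HOL-Algebra.Product_Groups"
begin

section \<open>Matrices over the integers modulo b and the Walsh figure of merit\<close>

text \<open>
  A matrix is an extensional function on the index set \<open>{1..s} \<times> {1..n}\<close>; its entries are
  the representatives \<open>0, \<dots>, b - 1\<close>, as integers.
\<close>

definition mat_group :: "nat \<Rightarrow> nat \<Rightarrow> nat \<Rightarrow> (nat \<times> nat \<Rightarrow> int) monoid" where
  "mat_group b s n = product_group ({1..s} \<times> {1..n}) (\<lambda>_. integer_mod_group b)"

definition omega :: "nat \<Rightarrow> complex" where
  "omega b = exp (2 * of_real pi * \<i> / of_nat b)"

definition mat_pairing ::
    "nat \<Rightarrow> nat \<Rightarrow> nat \<Rightarrow> (nat \<times> nat \<Rightarrow> int) \<Rightarrow> (nat \<times> nat \<Rightarrow> int) \<Rightarrow> complex" where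
  "mat_pairing b s n A B = (\<Prod>i=1..s. \<Prod>j=1..n. omega b powi (A (i, j) * B (i, j)))"

definition dual_group ::
    "nat \<Rightarrow> nat \<Rightarrow> nat \<Rightarrow> (nat \<times> nat \<Rightarrow> int) set \<Rightarrow> (nat \<times> nat \<Rightarrow> int) set" where
  "dual_group b s n P = {A \<in> carrier (mat_group b s n). \<forall>B\<in>P. mat_pairing b s n A B = 1}"

definition dick_weight :: "nat \<Rightarrow> nat \<Rightarrow> (nat \<times> nat \<Rightarrow> int) \<Rightarrow> nat" where
  "dick_weight s n A = (\<Sum>i=1..s. \<Sum>j=1..n. j * (if A (i, j) = 0 then 0 else 1))"

definition WF :: "nat \<Rightarrow> nat \<Rightarrow> nat \<Rightarrow> (nat \<times> nat \<Rightarrow> int) set \<Rightarrow> real" where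
  "WF b s n P = (\<Sum>A\<in>dual_group b s n P - {\<one>\<^bsub>mat_group b s n\<^esub>}. 1 / real b ^ dick_weight s n A)"


section \<open>Discretization\<close>

text \<open>
  A point of the Euclidean space with coordinates in a finite set \<open>I\<close> is an extensional function
  on \<open>I\<close>. For \<open>I = {}\<close> this space has one point, of measure 1.
\<close>

definition leb :: "nat set \<Rightarrow> (nat \<Rightarrow> real) measure" where
  "leb I = completion (\<Pi>\<^sub>M i\<in>I. lborel)"

definition cube :: "nat set \<Rightarrow> (nat \<Rightarrow> real) set" where
  "cube I = (\<Pi>\<^sub>E i\<in>I. {0..<1})"

definition mat_point :: "nat \<Rightarrow> nat \<Rightarrow> (nat \<times> nat \<Rightarrow> int) \<Rightarrow> nat \<Rightarrow> real" where
  "mat_point b n B i = (\<Sum>j=1..n. real_of_int (B (i, j)) / real b ^ j)"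

definition mat_box :: "nat \<Rightarrow> nat \<Rightarrow> nat \<Rightarrow> (nat \<times> nat \<Rightarrow> int) \<Rightarrow> (nat \<Rightarrow> real) set" where
  "mat_box b s n B =
     (\<Pi>\<^sub>E i\<in>{1..s}. {mat_point b n B i ..< mat_point b n B i + 1 / real b ^ n})"

definition discretization ::
    "nat \<Rightarrow> nat \<Rightarrow> nat \<Rightarrow> ((nat \<Rightarrow> real) \<Rightarrow> real) \<Rightarrow> (nat \<times> nat \<Rightarrow> int) \<Rightarrow> real" where
  "discretization b s n f B =
     1 / measure (leb {1..s}) (mat_box b s n B) * (LINT x:mat_box b s n B|leb {1..s}. f x)"

definition true_integral :: "nat \<Rightarrow> ((nat \<Rightarrow> real) \<Rightarrow> real) \<Rightarrow> real" where
  "true_integral s f = (LINT x:cube {1..s}|leb {1..s}. f x)"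

definition discretized_QMC ::
    "nat \<Rightarrow> nat \<Rightarrow> nat \<Rightarrow> (nat \<times> nat \<Rightarrow> int) set \<Rightarrow> ((nat \<Rightarrow> real) \<Rightarrow> real) \<Rightarrow> real" where
  "discretized_QMC b s n P f = 1 / real (card P) * (\<Sum>B\<in>P. discretization b s n f B)"

definition Err ::
    "nat \<Rightarrow> nat \<Rightarrow> nat \<Rightarrow> ((nat \<Rightarrow> real) \<Rightarrow> real) \<Rightarrow> (nat \<times> nat \<Rightarrow> int) set \<Rightarrow> real" where
  "Err b s n f P = \<bar>true_integral s f - discretized_QMC b s n P f\<bar>"


section \<open>Weak derivatives and the Sobolev norm\<close>

definition partial_deriv :: "nat \<Rightarrow> ((nat \<Rightarrow> real) \<Rightarrow> real) \<Rightarrow> (nat \<Rightarrow> real) \<Rightarrow> real" where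
  "partial_deriv i \<phi> x = deriv (\<lambda>t. \<phi> (x(i := t))) (x i)"

text \<open>
  Infinite differentiability is the existence and continuity of the iterated partial derivatives
  in every order of differentiation (the list \<open>is\<close> of coordinates). The topology is the
  product topology on \<open>nat \<Rightarrow> real\<close>, which on the extensional functions induces the Euclidean one.
\<close>

definition smooth_fun :: "nat \<Rightarrow> ((nat \<Rightarrow> real) \<Rightarrow> real) \<Rightarrow> bool" where
  "smooth_fun s \<phi> \<longleftrightarrow>
     (\<forall>is\<in>lists {1..s}.
        continuous_on (\<Pi>\<^sub>E i\<in>{1..s}. UNIV) (foldr partial_deriv is \<phi>) \<and>
        (\<forall>i\<in>{1..s}. \<forall>x\<in>(\<Pi>\<^sub>E i\<in>{1..s}. UNIV).
           (\<lambda>t. foldr partial_deriv is \<phi> (x(i := t))) differentiable (at (x i))))"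

definition test_function :: "nat \<Rightarrow> ((nat \<Rightarrow> real) \<Rightarrow> real) \<Rightarrow> bool" where
  "test_function s \<phi> \<longleftrightarrow> smooth_fun s \<phi> \<and>
     (\<exists>K. compact K \<and> K \<subseteq> (\<Pi>\<^sub>E i\<in>{1..s}. {0<..<1}) \<and>
          (\<forall>x\<in>(\<Pi>\<^sub>E i\<in>{1..s}. UNIV) - K. \<phi> x = 0))"

definition mixed_deriv ::
    "nat \<Rightarrow> (nat \<Rightarrow> nat) \<Rightarrow> ((nat \<Rightarrow> real) \<Rightarrow> real) \<Rightarrow> (nat \<Rightarrow> real) \<Rightarrow> real" where
  "mixed_deriv s \<alpha> \<phi> = foldr (\<lambda>i. partial_deriv i ^^ \<alpha> i) [1..<Suc s] \<phi>"

definition square_integrable :: "nat \<Rightarrow> ((nat \<Rightarrow> real) \<Rightarrow> real) \<Rightarrow> bool" where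
  "square_integrable s f \<longleftrightarrow>
     set_borel_measurable (leb {1..s}) (cube {1..s}) f \<and>
     set_integrable (leb {1..s}) (cube {1..s}) (\<lambda>x. (f x)\<^sup>2)"

text \<open>
  Square integrability of \<open>f\<close> itself is part of the notion: the integrals below have the default
  value 0 for functions that are not integrable.
\<close>

definition has_L2_weak_deriv ::
    "nat \<Rightarrow> (nat \<Rightarrow> nat) \<Rightarrow> ((nat \<Rightarrow> real) \<Rightarrow> real) \<Rightarrow> ((nat \<Rightarrow> real) \<Rightarrow> real) \<Rightarrow> bool" where
  "has_L2_weak_deriv s \<alpha> f g \<longleftrightarrow> square_integrable s f \<and> square_integrable s g \<and>
     (\<forall>\<phi>. test_function s \<phi> \<longrightarrow>
        (LINT x:cube {1..s}|leb {1..s}. f x * mixed_deriv s \<alpha> \<phi> x) =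
        (-1) ^ (\<Sum>i=1..s. \<alpha> i) * (LINT x:cube {1..s}|leb {1..s}. g x * \<phi> x))"

definition n_smooth :: "nat \<Rightarrow> nat \<Rightarrow> ((nat \<Rightarrow> real) \<Rightarrow> real) \<Rightarrow> bool" where
  "n_smooth s n f \<longleftrightarrow> (\<forall>\<tau>\<in>({1..s} \<rightarrow>\<^sub>E {0..n}). \<exists>g. has_L2_weak_deriv s \<tau> f g)"

text \<open>
  A weak derivative is unique up to null sets of the cube, so the choice of a representative does
  not affect the norm below.
\<close>

definition weak_deriv ::
    "nat \<Rightarrow> (nat \<Rightarrow> nat) \<Rightarrow> ((nat \<Rightarrow> real) \<Rightarrow> real) \<Rightarrow> (nat \<Rightarrow> real) \<Rightarrow> real" where
  "weak_deriv s \<alpha> f = (SOME g. has_L2_weak_deriv s \<alpha> f g)"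

text \<open>
  The domains of integration are half-open cubes, which differ from the closed ones by null sets.
\<close>

definition sobolev_norm :: "nat \<Rightarrow> nat \<Rightarrow> ((nat \<Rightarrow> real) \<Rightarrow> real) \<Rightarrow> real" where
  "sobolev_norm s n f = sqrt
     (\<Sum>u\<in>Pow {1..s}. \<Sum>\<tau>\<in>({1..s} - u) \<rightarrow>\<^sub>E {0..<n}.
        LINT x:cube u|leb u.
          \<bar>LINT y:cube ({1..s} - u)|leb ({1..s} - u).
             weak_deriv s (\<lambda>i\<in>{1..s}. if i \<in> u then n else \<tau> i) f (merge u ({1..s} - u) (x, y))\<bar>\<^sup>2)"

end

theory Submission
  imports Defs
begin

text \<open>
  The constant may depend on \<open>b\<close>, \<open>s\<close> and \<open>n\<close>, and for fixed \<open>b\<close>, \<open>s\<close>, \<open>n\<close> there are only finitely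
  many groups \<open>P\<close>. This splits the theorem into two independent halves.

  If the dual of \<open>P\<close> is trivial, then \<open>WF\<close> vanishes and the error has to vanish as well. Here
  \<open>P\<close> must be the whole matrix group: evaluating \<open>\<Sum>A. \<Sum>B\<in>P. A \<bullet> B\<close> in both orders by
  orthogonality of characters gives \<open>|P| |P\<^sup>\<bottom>| = b^(s n)\<close> (\<open>trivial_dual_imp_carrier\<close>). The boxes of
  all matrices partition the cube into pieces of equal volume (\<open>mem_mat_box_iff\<close>: the box that
  contains a point is read off from its base \<open>b\<close> digits), so the quadrature rule is exact
  (\<open>Err_carrier\<close>).

  Otherwise a single term already gives \<open>WF \<ge> b^(- s n n)\<close>, and it is enough to bound
  \<open>Err\<close> by a multiple of the Sobolev norm. As \<open>Err\<close> is a combination of finitely many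
  integrals of \<open>f\<close> over boxes, this is the estimate \<open>|\<integral>\<^sub>B f| \<le> K \<parallel>f\<parallel>\<close> for a box \<open>B\<close>
  (\<open>box_integral_bound\<close>), an embedding of Sobolev type. It is proved by duality, using only the
  defining identity of weak derivatives against tensor products of test functions. The indicator
  of an interval is a bounded limit of test functions \<open>\<phi>\<close>. For a fixed test function \<open>\<eta>\<close> of
  nonzero mean, subtracting a multiple of \<open>\<eta>\<close> makes the mean of \<open>\<phi>\<close> zero, so that \<open>\<phi> - c \<eta>\<close>
  is the derivative of a test function; after \<open>n\<close> steps
  \<open>\<phi> = c\<^sub>0 \<eta> + c\<^sub>1 \<eta>' + \<dots> + \<psi>\<^sup>(\<^sup>n\<^sup>)\<close> with bounds that do not depend on \<open>\<phi>\<close>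
  (\<open>test1_expand\<close>). Multiplying this out over the coordinates and moving the derivatives to \<open>f\<close>
  turns \<open>\<integral> f \<phi>\<close> into a sum over the multi-indices \<open>\<tau> \<in> {0..n}\<^sup>s\<close> of integrals of \<open>f\<^sup>(\<^sup>\<tau>\<^sup>)\<close> against
  a bounded function of the coordinates in \<open>u = {i. \<tau> i = n}\<close> times copies of \<open>\<eta>\<close> in the others.
  As \<open>\<eta>\<close> tends to 1, the other coordinates are averaged out, and by the inequality of
  Cauchy and Schwarz (\<open>marginal_bound\<close>) what remains is bounded by exactly the term of the Sobolev
  norm that belongs to \<open>u\<close> and \<open>\<tau>\<close>.
\<close>

section \<open>Smooth functions of one variable\<close>

text \<open>
  Only differentiability is demanded at each level, so the last derivative need not be continuous;
  the property for all \<open>m\<close> together is smoothness.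
\<close>

primrec Ck :: "nat \<Rightarrow> (real \<Rightarrow> real) \<Rightarrow> bool" where
  "Ck 0 f \<longleftrightarrow> True"
| "Ck (Suc m) f \<longleftrightarrow> (\<forall>x. f differentiable at x) \<and> Ck m (deriv f)"

lemma deriv_eqI: "(\<And>x. (f has_real_derivative g x) (at x)) \<Longrightarrow> deriv f = g"
  by (rule ext) (rule DERIV_imp_deriv)

lemma Ck_SucI:
  assumes "\<And>x. (f has_real_derivative g x) (at x)" "Ck m g"
  shows "Ck (Suc m) f"
  using assms deriv_eqI[OF assms(1)] by (auto simp: real_differentiable_def)

lemma Ck_SucE:
  assumes "Ck (Suc m) f"
  shows "(f has_real_derivative deriv f x) (at x)" "Ck m (deriv f)"
  using assms by (auto simp: real_differentiable_def DERIV_deriv_iff_real_differentiable)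

lemma Ck_mono: "Ck (Suc m) f \<Longrightarrow> Ck m f"
  by (induction m arbitrary: f) auto

lemma Ck_const: "Ck m (\<lambda>_. c)"
  by (induction m arbitrary: c) auto

lemma Ck_add: "Ck m f \<Longrightarrow> Ck m g \<Longrightarrow> Ck m (\<lambda>x. f x + g x)"
proof (induction m arbitrary: f g)
  case (Suc m)
  show ?case
    by (rule Ck_SucI[where g = "\<lambda>x. deriv f x + deriv g x"])
       (use Suc in \<open>auto intro!: DERIV_add Ck_SucE\<close>)
qed auto

lemma Ck_mult: "Ck m f \<Longrightarrow> Ck m g \<Longrightarrow> Ck m (\<lambda>x. f x * g x)"
proof (induction m arbitrary: f g)
  case (Suc m)
  show ?case
  proof (rule Ck_SucI[where g = "\<lambda>x. f x * deriv g x + deriv f x * g x"])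
    show "((\<lambda>x. f x * g x) has_real_derivative f x * deriv g x + deriv f x * g x) (at x)" for x
      using DERIV_mult'[OF Ck_SucE(1)[OF Suc.prems(1)] Ck_SucE(1)[OF Suc.prems(2)]] .
    show "Ck m (\<lambda>x. f x * deriv g x + deriv f x * g x)"
      using Suc.prems by (intro Ck_add Suc.IH Ck_SucE(2)) (auto dest: Ck_mono simp del: Ck.simps(2))
  qed
qed auto

lemma Ck_affine: "Ck m f \<Longrightarrow> Ck m (\<lambda>x. f (p * x + q))"
proof (induction m arbitrary: f)
  case (Suc m)
  show ?case
  proof (rule Ck_SucI[where g = "\<lambda>x. p * deriv f (p * x + q)"])
    show "((\<lambda>x. f (p * x + q)) has_real_derivative p * deriv f (p * x + q)) (at x)" for x
      by (rule DERIV_cong[OF DERIV_chain2[OF Ck_SucE(1)[OF Suc.prems]]])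
         (auto intro!: derivative_eq_intros)
    show "Ck m (\<lambda>x. p * deriv f (p * x + q))"
      using Suc by (intro Ck_mult Ck_const Suc.IH Ck_SucE(2))
  qed
qed auto

definition smooth :: "(real \<Rightarrow> real) \<Rightarrow> bool" where
  "smooth f \<longleftrightarrow> (\<forall>m. Ck m f)"

lemma smooth_cmult: "smooth f \<Longrightarrow> smooth (\<lambda>x. c * f x)"
  unfolding smooth_def by (intro allI Ck_mult Ck_const) auto

lemma smooth_diff: "smooth f \<Longrightarrow> smooth g \<Longrightarrow> smooth (\<lambda>x. f x - g x)"
  unfolding smooth_def
proof
  fix m assume *: "\<forall>m. Ck m f" "\<forall>m. Ck m g"
  have "Ck m (\<lambda>x. f x + (- 1) * g x)"
    using * by (intro Ck_add Ck_mult Ck_const) auto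
  then show "Ck m (\<lambda>x. f x - g x)" by simp
qed

lemma smooth_deriv: "smooth f \<Longrightarrow> smooth (deriv f)"
  unfolding smooth_def using Ck_SucE(2) by blast

lemma smooth_has_deriv: "smooth f \<Longrightarrow> (f has_real_derivative deriv f x) (at x)"
  using Ck_SucE(1)[of 0] unfolding smooth_def by blast

lemma smooth_antideriv:
  assumes "\<And>x. (f has_real_derivative g x) (at x)" "smooth g"
  shows "smooth f"
  unfolding smooth_def
proof
  show "Ck m f" for m
    using assms(2) by (intro Ck_mono[OF Ck_SucI[OF assms(1)]]) (simp add: smooth_def)
qed

text \<open>
  \<open>flat 1\<close> is the classical smooth function \<open>exp (- 1/x)\<close> that is flat at 0. Its derivatives are
  polynomials in \<open>1/x\<close> times the same exponential, so this family is closed under differentiation.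
\<close>

definition flat :: "real poly \<Rightarrow> real \<Rightarrow> real" where
  "flat p x = (if x > 0 then poly p (inverse x) * exp (- inverse x) else 0)"

lemma poly_exp_tendsto_0: "((\<lambda>y. poly p y * exp (- y)) \<longlongrightarrow> (0::real)) at_top"
proof -
  have "((\<lambda>y. \<Sum>i\<le>degree p. coeff p i * (y ^ i / exp y)) \<longlongrightarrow> (\<Sum>i\<le>degree p. coeff p i * 0)) at_top"
    by (intro tendsto_intros tendsto_power_div_exp_0)
  then show ?thesis
    by (simp add: poly_altdef exp_minus sum_distrib_right divide_inverse mult.assoc)
qed

text \<open>
  Away from 0 this is a computation; at 0 the exponential decay beats every power of \<open>1/x\<close>.
\<close>

lemma flat_has_deriv:
  "(flat p has_real_derivative flat ([:0, 0, 1:] * (p - pderiv p)) x) (at x)"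
proof -
  consider "x < 0" | "x > 0" | "x = 0" by linarith
  then show ?thesis
  proof cases
    case 1
    have "((\<lambda>_. 0) has_real_derivative 0) (at x)" by simp
    then have "(flat p has_real_derivative 0) (at x)"
      by (rule has_field_derivative_transform_within_open[of _ _ _ "{..<0}"])
         (use 1 in \<open>auto simp: flat_def\<close>)
    then show ?thesis using 1 by (simp add: flat_def)
  next
    case 2
    have "((\<lambda>x. poly p (inverse x) * exp (- inverse x)) has_real_derivative
        flat ([:0, 0, 1:] * (p - pderiv p)) x) (at x)"
      using 2 by (auto intro!: derivative_eq_intros DERIV_chain2[OF poly_DERIV]
          simp: flat_def field_simps power2_eq_square)
    then show ?thesis
      by (rule has_field_derivative_transform_within_open[of _ _ _ "{0<..}"])
         (use 2 in \<open>auto simp: flat_def\<close>)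
  next
    case 3
    have "((\<lambda>h. flat p h / h) \<longlongrightarrow> 0) (at_right 0)"
    proof -
      have "((\<lambda>h. poly (pCons 0 p) (inverse h) * exp (- inverse h)) \<longlongrightarrow> 0) (at_right (0::real))"
        by (rule filterlim_compose[OF poly_exp_tendsto_0 filterlim_inverse_at_top_right])
      then show ?thesis
        by (rule Lim_transform_eventually)
           (auto simp: eventually_at_filter flat_def divide_inverse intro!: always_eventually)
    qed
    moreover have "((\<lambda>h. flat p h / h) \<longlongrightarrow> 0) (at_left 0)"
      by (rule Lim_transform_eventually[OF tendsto_const])
         (auto simp: eventually_at_filter flat_def intro!: always_eventually)
    ultimately have "((\<lambda>h. flat p h / h) \<longlongrightarrow> 0) (at 0)"
      by (simp add: filterlim_split_at)
    then show ?thesis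
      using 3 by (simp add: DERIV_def flat_def[of _ 0])
  qed
qed

lemma smooth_flat: "smooth (flat p)"
proof -
  have "Ck m (flat p)" for m
    by (induction m arbitrary: p) (auto intro!: Ck_SucI[OF flat_has_deriv] simp del: Ck.simps(2))
  then show ?thesis by (simp add: smooth_def)
qed

definition test1 :: "(real \<Rightarrow> real) \<Rightarrow> bool" where
  "test1 \<phi> \<longleftrightarrow> smooth \<phi> \<and> (\<exists>a b. 0 < a \<and> b < 1 \<and> (\<forall>x. x < a \<or> b < x \<longrightarrow> \<phi> x = 0))"

lemma test1_deriv: "test1 \<phi> \<Longrightarrow> test1 (deriv \<phi>)"
proof -
  assume "test1 \<phi>"
  then obtain a b where s: "smooth \<phi>" and ab: "0 < a" "b < 1" "\<And>x. x < a \<or> b < x \<Longrightarrow> \<phi> x = 0"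
    by (auto simp: test1_def)
  have "deriv \<phi> x = 0" if "x < a \<or> b < x" for x
  proof -
    have "((\<lambda>_. 0) has_real_derivative 0) (at x)" by simp
    then have "(\<phi> has_real_derivative 0) (at x)"
      by (rule has_field_derivative_transform_within_open[of _ _ _ "{..<a} \<union> {b<..}"])
         (use that ab in auto)
    then show ?thesis by (rule DERIV_imp_deriv)
  qed
  then show ?thesis
    unfolding test1_def using ab s smooth_deriv by blast
qed

lemma test1_smooth: "test1 \<phi> \<Longrightarrow> smooth \<phi>"
  by (simp add: test1_def)

lemma test1_higher_deriv: "test1 \<phi> \<Longrightarrow> test1 ((deriv ^^ m) \<phi>)"
  by (induction m) (auto intro: test1_deriv)

lemma test1_continuous: "test1 \<phi> \<Longrightarrow> continuous_on S \<phi>"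
  by (intro continuous_at_imp_continuous_on ballI DERIV_isCont[OF smooth_has_deriv] test1_smooth)

text \<open>
  Two flat functions facing each other; the shift by 1 keeps the support at distance
  \<open>1/(k + 1)\<close> from the end points. The values tend to 1 between the end points, because
  \<open>exp (- 1/y)\<close> tends to 1 for large \<open>y\<close>.
\<close>

definition bump :: "real \<Rightarrow> real \<Rightarrow> nat \<Rightarrow> real \<Rightarrow> real" where
  "bump a b k x = flat 1 (real (Suc k) * (x - a) - 1) * flat 1 (real (Suc k) * (b - x) - 1)"

lemma test1_bump:
  assumes "0 \<le> a" "b \<le> 1"
  shows "test1 (bump a b k)"
  unfolding test1_def
proof (intro conjI exI allI impI)
  have *: "bump a b k = (\<lambda>x. flat 1 (real (Suc k) * x + (- real (Suc k) * a - 1)) *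
      flat 1 (- real (Suc k) * x + (real (Suc k) * b - 1)))"
    by (auto simp: bump_def fun_eq_iff algebra_simps)
  show "smooth (bump a b k)"
    unfolding * using smooth_flat[of 1] by (auto simp: smooth_def simp del: mult_minus_left intro!: Ck_mult Ck_affine)
  show "0 < a + 1 / real (Suc k)" "b - 1 / real (Suc k) < 1" 
    using assms by (smt (verit) divide_pos_pos of_nat_0_less_iff zero_less_Suc)+
  show "bump a b k x = 0" if "x < a + 1 / real (Suc k) \<or> b - 1 / real (Suc k) < x" for x
    using that by (auto simp: bump_def flat_def field_simps)
qed

lemma flat_1_bounds: "0 \<le> flat 1 x" "flat 1 x \<le> 1"
  by (auto simp: flat_def)

lemma bump_bounds: "0 \<le> bump a b k x" "bump a b k x \<le> 1"
  by (auto simp: bump_def flat_1_bounds mult_le_one)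

lemma flat_1_tendsto:
  assumes "c > 0"
  shows "(\<lambda>k. flat 1 (real (Suc k) * c - 1)) \<longlonglongrightarrow> 1"
proof -
  have "filterlim (\<lambda>k. real (Suc k) * c - 1) at_top sequentially"
    using assms by real_asymp
  moreover have "(flat 1 \<longlongrightarrow> 1) at_top"
  proof -
    have "((\<lambda>x. exp (- inverse x)) \<longlongrightarrow> (1::real)) at_top" by real_asymp
    then show ?thesis
      by (rule Lim_transform_eventually)
         (use eventually_gt_at_top[of 0] in eventually_elim, simp add: flat_def)
  qed
  ultimately show ?thesis by (rule filterlim_compose[rotated])
qed

text \<open>
  At \<open>a\<close> itself all the bumps vanish while the indicator of the half-open interval is 1;
  this point is the only exception.
\<close>

lemma bump_tendsto:
  assumes "x \<noteq> a"
  shows "(\<lambda>k. bump a b k x) \<longlonglongrightarrow> indicator {a..<b} x"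
proof (cases "a < x \<and> x < b")
  case True
  have "(\<lambda>k. bump a b k x) \<longlonglongrightarrow> 1 * 1"
    unfolding bump_def using True by (intro tendsto_mult flat_1_tendsto) auto
  then show ?thesis using True by simp
next
  case False
  have *: "flat 1 (real (Suc k) * y - 1) = 0" if "y \<le> 0" for y k
    using mult_nonneg_nonpos[of "real (Suc k)" y] that by (simp add: flat_def)
  have "bump a b k x = 0" for k
    using False *[of "x - a"] *[of "b - x"] assms by (cases "a < x") (auto simp: bump_def)
  then show ?thesis using False assms by (auto simp: indicator_def)
qed

lemma test1_antideriv:
  assumes "test1 \<phi>" obtains F where "\<And>x. (F has_real_derivative \<phi> x) (at x)"
proof -
  have "isCont \<phi> x" for x
    using assms test1_smooth smooth_has_deriv DERIV_isCont by blast
  from einterval_antiderivative[of "-\<infinity>" "\<infinity>" \<phi>, OF _ this] show thesis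
    using that by (auto simp: has_real_derivative_iff_has_vector_derivative)
qed

text \<open>
  The integral over the unit interval is at least \<open>1/4\<close>, expressed by antiderivatives. A lower
  bound that is uniform in \<open>k\<close> is what keeps the coefficient \<open>c\<close> in the splitting of test functions
  bounded along the sequence \<open>bump 0 1 k\<close>.
\<close>

definition broad :: "(real \<Rightarrow> real) \<Rightarrow> bool" where
  "broad \<eta> \<longleftrightarrow> (\<forall>F. (\<forall>x. (F has_real_derivative \<eta> x) (at x)) \<longrightarrow> F 1 - F 0 \<ge> 1/4)"

text \<open>
  On the middle half of the unit interval both factors are at least \<open>3/4\<close> once \<open>k + 1 \<ge> 20\<close>.
\<close>

lemma broad_bump:
  assumes "k \<ge> 19" shows "broad (bump 0 1 k)"
  unfolding broad_def
proof (intro allI impI)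
  fix F assume F: "\<forall>x. (F has_real_derivative bump 0 1 k x) (at x)"
  have mono: "F x \<le> F y" if "x \<le> y" for x y
  proof (rule DERIV_nonneg_imp_nondecreasing[OF that])
    show "\<exists>y. (F has_real_derivative y) (at t) \<and> 0 \<le> y" for t
      using F bump_bounds(1)[of 0 1 k t] by blast
  qed
  have half: "exp (- (1/4)) \<ge> (3/4::real)"
    using exp_ge_add_one_self[of "-(1/4)::real"] by simp
  have fl: "flat 1 (real (Suc k) * y - 1) \<ge> 3/4" if "y \<ge> 1/4" for y
  proof -
    have "real (Suc k) * y \<ge> 20 * (1/4)"
      using assms that by (intro mult_mono) auto
    then have *: "real (Suc k) * y - 1 \<ge> 4" by simp
    then have "inverse (real (Suc k) * y - 1) \<le> 1/4"
      using le_imp_inverse_le[OF *] by simp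
    then have "exp (- inverse (real (Suc k) * y - 1)) \<ge> exp (-(1/4))"
      by (subst exp_le_cancel_iff) simp
    with half have "3/4 \<le> exp (- inverse (real (Suc k) * y - 1))" by (rule order_trans)
    then show ?thesis unfolding flat_def using * by (simp del: of_nat_Suc)
  qed
  have "bump 0 1 k x \<ge> 1/2" if "1/4 < x" "x < 3/4" for x
  proof -
    have "3/4 * (3/4) \<le> bump 0 1 k x"
      unfolding bump_def using that by (intro mult_mono fl flat_1_bounds) auto
    then show ?thesis by simp
  qed
  moreover have "\<exists>z::real. 1/4 < z \<and> z < 3/4 \<and> F (3/4) - F (1/4) = (3/4 - 1/4) * bump 0 1 k z"
    using F by (intro MVT2) auto
  ultimately have "F (3/4) - F (1/4) \<ge> 1/4" by fastforce
  with mono[of 0 "1/4"] mono[of "3/4" 1] show "1/4 \<le> F 1 - F 0" by simp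
qed

text \<open>
  The coefficient \<open>c\<close> is the quotient of the means of \<open>\<phi>\<close> and \<open>\<eta>\<close>. Then \<open>\<phi> - c \<eta>\<close> has mean zero,
  and this is exactly the condition for its antiderivative that vanishes at 0 to vanish again to
  the right of the support. With \<open>|c| \<le> M / (1/4)\<close> the integrand is at most \<open>M + 4 M\<close>, which is
  the origin of the factor 5.
\<close>

lemma test1_split:
  assumes \<phi>: "test1 \<phi>" "\<And>x. \<bar>\<phi> x\<bar> \<le> M" and \<eta>: "test1 \<eta>" "\<And>x. \<bar>\<eta> x\<bar> \<le> 1" "broad \<eta>"
  shows "\<exists>c \<psi>. test1 \<psi> \<and> \<bar>c\<bar> \<le> 5 * M \<and> (\<forall>x. \<bar>\<psi> x\<bar> \<le> 5 * M) \<and> \<phi> = (\<lambda>x. c * \<eta> x + deriv \<psi> x)"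
proof -
  have M: "M \<ge> 0" using \<phi>(2)[of 0] by linarith
  obtain F where F: "\<And>x. (F has_real_derivative \<phi> x) (at x)" using test1_antideriv[OF \<phi>(1)] by blast
  obtain G where G: "\<And>x. (G has_real_derivative \<eta> x) (at x)" using test1_antideriv[OF \<eta>(1)] by blast
  have G4: "G 1 - G 0 \<ge> 1/4" using \<eta>(3) G by (auto simp: broad_def)
  obtain z where z: "F 1 - F 0 = \<phi> z"
    using MVT2[of 0 1 F \<phi>] F by auto
  define c where "c = (F 1 - F 0) / (G 1 - G 0)"
  have "\<bar>c\<bar> \<le> M / (1/4)"
    unfolding c_def z abs_divide using G4 \<phi>(2)[of z] M by (intro frac_le) auto
  then have c: "\<bar>c\<bar> \<le> 4 * M" by simp
  \<comment> \<open>The antiderivative of \<open>\<phi> - c \<eta>\<close> that vanishes at 0; the choice of \<open>c\<close> makes it vanish at 1.\<close>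
  define H where "H x = F x - c * G x - (F 0 - c * G 0)" for x
  have H: "(H has_real_derivative \<phi> x - c * \<eta> x) (at x)" for x
    unfolding H_def by (auto intro!: derivative_eq_intros F G)
  have H01: "H 0 = 0" "H 1 = 0"
    using G4 by (auto simp: H_def c_def field_simps)
  obtain a b where ab: "0 < a" "b < 1" "\<And>x. x < a \<or> b < x \<Longrightarrow> \<phi> x = 0"
    using \<phi>(1) by (auto simp: test1_def)
  obtain a' b' where ab': "0 < a'" "b' < 1" "\<And>x. x < a' \<or> b' < x \<Longrightarrow> \<eta> x = 0"
    using \<eta>(1) by (auto simp: test1_def)
  have d0: "\<phi> x - c * \<eta> x = 0" if "x < min a a' \<or> max b b' < x" for x
    using that ab(3)[of x] ab'(3)[of x] by auto
  have Hc: "H x = H y" if "\<And>t. t \<in> S \<Longrightarrow> \<phi> t - c * \<eta> t = 0" "convex S" "x \<in> S" "y \<in> S" for S x y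
    using has_field_derivative_zero_constant[of S H] that H
    by (metis has_field_derivative_at_within)
  have Hl: "H x = 0" if "x < min a a'" for x
    using Hc[of "{..<min a a'}" x 0] that d0 ab ab' H01 by auto
  have Hr: "H x = 0" if "x > max b b'" for x
    using Hc[of "{max b b'<..}" x 1] that d0 ab ab' H01 by auto
  have "test1 H"
    unfolding test1_def
  proof (intro conjI exI allI impI)
    show "smooth H"
      using H by (rule smooth_antideriv) (intro smooth_diff smooth_cmult test1_smooth \<phi> \<eta>)
    show "0 < min a a'" "max b b' < 1" using ab ab' by auto
    show "H x = 0" if "x < min a a' \<or> max b b' < x" for x
      using that Hl Hr by blast
  qed
  moreover have "\<bar>H x\<bar> \<le> 5 * M" for x
  proof (cases "0 < x \<and> x \<le> 1")
    case True
    obtain w where w: "H x - H 0 = (x - 0) * (\<phi> w - c * \<eta> w)"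
      using MVT2[of 0 x H "\<lambda>x. \<phi> x - c * \<eta> x"] H True by auto
    have "\<bar>c * \<eta> w\<bar> \<le> 4 * M * 1"
      unfolding abs_mult using c \<eta>(2)[of w] M by (intro mult_mono) auto
    then have "\<bar>\<phi> w - c * \<eta> w\<bar> \<le> 5 * M"
      using \<phi>(2)[of w] by linarith
    then have "\<bar>x\<bar> * \<bar>\<phi> w - c * \<eta> w\<bar> \<le> 1 * (5 * M)"
      using True by (intro mult_mono) auto
    then show ?thesis using w by (simp add: H01 abs_mult)
  next
    case False
    then have "H x = 0" using Hl[of x] Hr[of x] ab ab' H01 by (cases "x = 0") auto
    then show ?thesis using M by simp
  qed
  moreover have "\<phi> = (\<lambda>x. c * \<eta> x + deriv H x)"
    using deriv_eqI[of H, OF H] by auto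
  ultimately show ?thesis using c M by (intro exI[of _ c] exI[of _ H]) auto
qed

lemma higher_deriv_lincomb:
  assumes "test1 \<eta>" "test1 \<psi>"
  shows "(deriv ^^ m) (\<lambda>x. c * \<eta> x + \<psi> x) = (\<lambda>x. c * (deriv ^^ m) \<eta> x + (deriv ^^ m) \<psi> x)"
proof (induction m)
  case (Suc m)
  have "deriv (\<lambda>x. c * (deriv ^^ m) \<eta> x + (deriv ^^ m) \<psi> x) =
      (\<lambda>x. c * deriv ((deriv ^^ m) \<eta>) x + deriv ((deriv ^^ m) \<psi>) x)"
    using assms by (intro deriv_eqI DERIV_add DERIV_cmult smooth_has_deriv test1_smooth test1_higher_deriv)
  then show ?case by (simp add: Suc.IH)
qed simp

text \<open>
  Apply the splitting to the remainder \<open>\<psi>\<close> repeatedly. The point is that the bounds depend on \<open>n\<close>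
  only.
\<close>

lemma test1_expand:
  assumes \<phi>: "test1 \<phi>" "\<And>x. \<bar>\<phi> x\<bar> \<le> 1" and \<eta>: "test1 \<eta>" "\<And>x. \<bar>\<eta> x\<bar> \<le> 1" "broad \<eta>"
  shows "\<exists>c \<psi>. test1 \<psi> \<and> (\<forall>x. \<bar>\<psi> x\<bar> \<le> 5 ^ n) \<and> (\<forall>m. \<bar>c m\<bar> \<le> 5 ^ n) \<and>
    \<phi> = (\<lambda>x. (\<Sum>m<n. c m * (deriv ^^ m) \<eta> x) + (deriv ^^ n) \<psi> x)"
proof (induction n)
  case 0
  show ?case using \<phi> by (intro exI[of _ "\<lambda>_. 0"] exI[of _ \<phi>]) auto
next
  case (Suc n)
  then obtain c \<psi> where IH: "test1 \<psi>" "\<And>x. \<bar>\<psi> x\<bar> \<le> 5 ^ n" "\<And>m. \<bar>c m\<bar> \<le> 5 ^ n"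
    "\<phi> = (\<lambda>x. (\<Sum>m<n. c m * (deriv ^^ m) \<eta> x) + (deriv ^^ n) \<psi> x)" by blast
  from test1_split[OF IH(1,2) \<eta>] obtain d \<xi> where d: "test1 \<xi>" "\<bar>d\<bar> \<le> 5 * 5 ^ n"
    "\<And>x. \<bar>\<xi> x\<bar> \<le> 5 * 5 ^ n" "\<psi> = (\<lambda>x. d * \<eta> x + deriv \<xi> x)" by blast
  have "(deriv ^^ n) (\<lambda>x. d * \<eta> x + deriv \<xi> x) =
      (\<lambda>x. d * (deriv ^^ n) \<eta> x + (deriv ^^ Suc n) \<xi> x)"
    using higher_deriv_lincomb[OF \<eta>(1) test1_deriv[OF d(1)]] by (simp add: funpow_swap1)
  then have eq: "(deriv ^^ n) \<psi> x = d * (deriv ^^ n) \<eta> x + (deriv ^^ Suc n) \<xi> x" for x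
    by (simp only: d(4)[symmetric])
  have "\<phi> = (\<lambda>x. (\<Sum>m<Suc n. (c(n := d)) m * (deriv ^^ m) \<eta> x) + (deriv ^^ Suc n) \<xi> x)"
    by (subst IH(4)) (simp add: eq fun_eq_iff)
  moreover have "\<bar>(c(n := d)) m\<bar> \<le> 5 ^ Suc n" for m
  proof (cases "m = n")
    case False
    have "(5::real) ^ n \<le> 5 ^ Suc n" by simp
    with False IH(3)[of m] show ?thesis by auto
  qed (use d(2) in simp)
  ultimately show ?case
    using d(1,3) by (intro exI[of _ "c(n := d)"] exI[of _ \<xi>]) auto
qed

section \<open>Tensor products of test functions\<close>

definition tensor :: "nat \<Rightarrow> (nat \<Rightarrow> real \<Rightarrow> real) \<Rightarrow> (nat \<Rightarrow> real) \<Rightarrow> real" where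
  "tensor s \<zeta> x = (\<Prod>i\<in>{1..s}. \<zeta> i (x i))"

lemma tensor_upd:
  assumes "i \<in> {1..s}"
  shows "tensor s \<zeta> (x(i := t)) = \<zeta> i t * (\<Prod>j\<in>{1..s} - {i}. \<zeta> j (x j))"
proof -
  have "tensor s \<zeta> (x(i := t)) = \<zeta> i t * (\<Prod>j\<in>{1..s} - {i}. \<zeta> j ((x(i := t)) j))"
    unfolding tensor_def using assms by (subst prod.remove[of _ i]) auto
  also have "(\<Prod>j\<in>{1..s} - {i}. \<zeta> j ((x(i := t)) j)) = (\<Prod>j\<in>{1..s} - {i}. \<zeta> j (x j))"
    by (rule prod.cong) auto
  finally show ?thesis .
qed

lemma tensor_fun_upd:
  assumes "i \<in> {1..s}"
  shows "tensor s (\<zeta>(i := g)) x = g (x i) * (\<Prod>j\<in>{1..s} - {i}. \<zeta> j (x j))"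
proof -
  have "tensor s (\<zeta>(i := g)) x = g (x i) * (\<Prod>j\<in>{1..s} - {i}. (\<zeta>(i := g)) j (x j))"
    unfolding tensor_def using assms by (subst prod.remove[of _ i]) auto
  also have "(\<Prod>j\<in>{1..s} - {i}. (\<zeta>(i := g)) j (x j)) = (\<Prod>j\<in>{1..s} - {i}. \<zeta> j (x j))"
    by (rule prod.cong) auto
  finally show ?thesis .
qed

lemma tensor_has_deriv:
  assumes "i \<in> {1..s}" "smooth (\<zeta> i)"
  shows "((\<lambda>t. tensor s \<zeta> (x(i := t))) has_real_derivative tensor s (\<zeta>(i := deriv (\<zeta> i))) x) (at (x i))"
  unfolding tensor_upd[OF assms(1)] tensor_fun_upd[OF assms(1)]
  by (intro DERIV_cmult_right smooth_has_deriv assms)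

lemma partial_deriv_tensor:
  assumes "i \<in> {1..s}" "smooth (\<zeta> i)"
  shows "partial_deriv i (tensor s \<zeta>) = tensor s (\<zeta>(i := deriv (\<zeta> i)))"
  unfolding partial_deriv_def by (rule ext) (intro DERIV_imp_deriv tensor_has_deriv assms)

text \<open>
  Each partial derivative acts on a single factor, so the order of differentiation is immaterial
  and the symmetry of higher derivatives is never an issue.
\<close>

lemma iterated_partial_deriv_tensor:
  assumes "is \<in> lists {1..s}" "\<And>i. smooth (\<zeta> i)"
  shows "\<exists>\<xi>. (\<forall>i. smooth (\<xi> i)) \<and> foldr partial_deriv is (tensor s \<zeta>) = tensor s \<xi>"
  using assms(1)
proof (induction "is")
  case Nil
  then show ?case using assms(2) by auto
next
  case (Cons i "is")
  then obtain \<xi> where \<xi>: "\<forall>i. smooth (\<xi> i)" "foldr partial_deriv is (tensor s \<zeta>) = tensor s \<xi>" by auto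
  have "partial_deriv i (tensor s \<xi>) = tensor s (\<xi>(i := deriv (\<xi> i)))"
    using Cons.hyps \<xi> by (intro partial_deriv_tensor) auto
  then show ?case
    using \<xi> by (intro exI[of _ "\<xi>(i := deriv (\<xi> i))"]) (auto intro: smooth_deriv simp: fun_upd_def)
qed

lemma continuous_on_tensor:
  assumes "\<And>i. smooth (\<zeta> i)"
  shows "continuous_on S (tensor s \<zeta>)"
proof -
  have "continuous_on UNIV (\<zeta> i)" for i
    by (intro continuous_at_imp_continuous_on ballI DERIV_isCont[OF smooth_has_deriv] assms)
  then have "continuous_on S (\<lambda>x. \<zeta> i (x i))" for i
    by (rule continuous_on_compose2)
       (rule continuous_on_subset[OF continuous_on_product_coordinates], simp_all)
  then show ?thesis
    unfolding tensor_def[abs_def] by (intro continuous_on_prod)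
qed

lemma smooth_fun_tensor:
  assumes "\<And>i. smooth (\<zeta> i)"
  shows "smooth_fun s (tensor s \<zeta>)"
  unfolding smooth_fun_def
proof (intro ballI conjI)
  fix "is" assume "is \<in> lists {1..s}"
  from iterated_partial_deriv_tensor[of _ s \<zeta>, OF this assms]
  obtain \<xi> where \<xi>: "\<And>i. smooth (\<xi> i)" "foldr partial_deriv is (tensor s \<zeta>) = tensor s \<xi>" by auto
  show "continuous_on (\<Pi>\<^sub>E i\<in>{1..s}. UNIV) (foldr partial_deriv is (tensor s \<zeta>))"
    unfolding \<xi>(2) by (rule continuous_on_tensor[OF \<xi>(1)])
  show "(\<lambda>t. foldr partial_deriv is (tensor s \<zeta>) (x(i := t))) differentiable (at (x i))"
    if "i \<in> {1..s}" for i x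
    unfolding \<xi>(2) using tensor_has_deriv[of i s \<xi>, OF that \<xi>(1)] real_differentiable_def by blast
qed

text \<open>
  Extensional functions live in the full product space with the single value \<open>undefined\<close> outside
  \<open>I\<close>, so the box is a full product of compact sets and the theorem of Tychonoff applies.
\<close>

lemma compact_PiE_real:
  fixes a b :: "'i \<Rightarrow> real"
  shows "compact (\<Pi>\<^sub>E i\<in>I. {a i..b i})"
proof -
  have "(\<Pi>\<^sub>E i\<in>I. {a i..b i}) = (\<Pi>\<^sub>E i\<in>UNIV. if i \<in> I then {a i..b i} else {undefined})"
    by (auto simp: PiE_iff extensional_def split: if_splits)
  moreover have "compactin (product_topology (\<lambda>_. euclidean) UNIV)
      (\<Pi>\<^sub>E i\<in>UNIV. if i \<in> I then {a i..b i} else {undefined})"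
    by (subst compactin_PiE) (auto simp: compactin_euclidean_iff)
  ultimately show ?thesis
    by (simp add: euclidean_product_topology)
qed

lemma test_function_tensor:
  assumes "\<And>i. test1 (\<zeta> i)"
  shows "test_function s (tensor s \<zeta>)"
proof -
  have "\<forall>i. \<exists>a b. 0 < a \<and> b < 1 \<and> (\<forall>x. x < a \<or> b < x \<longrightarrow> \<zeta> i x = 0)"
    using assms by (simp add: test1_def)
  then obtain a b where ab: "\<And>i. 0 < a i" "\<And>i. b i < 1" "\<And>i x. x < a i \<or> b i < x \<Longrightarrow> \<zeta> i x = (0::real)"
    by metis
  have "tensor s \<zeta> x = 0" if "x \<in> (\<Pi>\<^sub>E i\<in>{1..s}. UNIV) - (\<Pi>\<^sub>E i\<in>{1..s}. {a i..b i})" for x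
  proof -
    from that obtain i where i: "i \<in> {1..s}" "x i < a i \<or> b i < x i"
      by (auto simp: PiE_iff not_le)
    then have "\<zeta> i (x i) = 0" using ab(3) by blast
    then show ?thesis unfolding tensor_def using i(1) by (intro prod_zero) auto
  qed
  moreover have "(\<Pi>\<^sub>E i\<in>{1..s}. {a i..b i}) \<subseteq> (\<Pi>\<^sub>E i\<in>{1..s}. {0<..<1})"
  proof (rule PiE_mono)
    show "{a i..b i} \<subseteq> {0<..<1}" for i using ab(1,2)[of i] by auto
  qed
  ultimately show ?thesis
    unfolding test_function_def using assms
    by (intro conjI exI[of _ "\<Pi>\<^sub>E i\<in>{1..s}. {a i..b i}"] smooth_fun_tensor test1_smooth compact_PiE_real) auto
qed

lemma funpow_partial_deriv_tensor:
  assumes "i \<in> {1..s}" "\<And>i. smooth (\<zeta> i)"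
  shows "(partial_deriv i ^^ m) (tensor s \<zeta>) = tensor s (\<zeta>(i := (deriv ^^ m) (\<zeta> i)))"
proof (induction m)
  case (Suc m)
  have sm: "smooth ((deriv ^^ m) (\<zeta> i))"
    by (induction m) (auto intro: smooth_deriv assms)
  then have "partial_deriv i (tensor s (\<zeta>(i := (deriv ^^ m) (\<zeta> i)))) =
      tensor s (\<zeta>(i := deriv ((deriv ^^ m) (\<zeta> i))))"
    by (subst partial_deriv_tensor[OF assms(1)]) auto
  then show ?case by (simp add: Suc.IH del: fun_upd_apply)
qed simp

lemma mixed_deriv_tensor:
  assumes "\<And>i. smooth (\<zeta> i)"
  shows "mixed_deriv s \<alpha> (tensor s \<zeta>) = tensor s (\<lambda>i. (deriv ^^ \<alpha> i) (\<zeta> i))"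
proof -
  have sm: "smooth ((deriv ^^ m) (\<zeta> i))" for m i
    by (induction m) (auto intro: smooth_deriv assms)
  have *: "foldr (\<lambda>i. partial_deriv i ^^ \<alpha> i) is (tensor s \<zeta>) =
      tensor s (\<lambda>i. if i \<in> set is then (deriv ^^ \<alpha> i) (\<zeta> i) else \<zeta> i)"
    if "distinct is" "set is \<subseteq> {1..s}" for "is"
    using that
  proof (induction "is")
    case (Cons i "is")
    let ?\<xi> = "\<lambda>i. if i \<in> set is then (deriv ^^ \<alpha> i) (\<zeta> i) else \<zeta> i"
    have "foldr (\<lambda>i. partial_deriv i ^^ \<alpha> i) (i # is) (tensor s \<zeta>) = (partial_deriv i ^^ \<alpha> i) (tensor s ?\<xi>)"
      using Cons by simp
    also have "\<dots> = tensor s (?\<xi>(i := (deriv ^^ \<alpha> i) (?\<xi> i)))"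
      using Cons.prems by (intro funpow_partial_deriv_tensor) (auto simp: sm assms)
    also have "?\<xi>(i := (deriv ^^ \<alpha> i) (?\<xi> i)) =
        (\<lambda>j. if j \<in> set (i # is) then (deriv ^^ \<alpha> j) (\<zeta> j) else \<zeta> j)"
      using Cons.prems by (auto simp: fun_eq_iff)
    finally show ?case .
  qed simp
  have "tensor s (\<lambda>i. if i \<in> {1..<Suc s} then (deriv ^^ \<alpha> i) (\<zeta> i) else \<zeta> i) =
      tensor s (\<lambda>i. (deriv ^^ \<alpha> i) (\<zeta> i))"
    unfolding tensor_def[abs_def] by (intro ext prod.cong) auto
  with *[of "[1..<Suc s]"] show ?thesis
    unfolding mixed_deriv_def set_upt by (auto simp: atLeastLessThanSuc_atLeastAtMost simp del: upt_Suc)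
qed

section \<open>Square integrable functions on the cube\<close>

abbreviation lebP :: "nat set \<Rightarrow> (nat \<Rightarrow> real) measure" where
  "lebP I \<equiv> \<Pi>\<^sub>M i\<in>I. lborel"

lemma product_sigma_finite_lborel: "product_sigma_finite (\<lambda>_::nat. lborel :: real measure)"
  by (simp add: product_sigma_finite_def sigma_finite_lborel)

lemma sigma_finite_lebP: "finite I \<Longrightarrow> sigma_finite_measure (lebP I)"
  by (rule product_sigma_finite.sigma_finite[OF product_sigma_finite_lborel])

lemma emeasure_lebP_PiE:
  assumes "finite I" "\<And>i. i \<in> I \<Longrightarrow> A i \<in> sets borel"
  shows "emeasure (lebP I) (Pi\<^sub>E I A) = (\<Prod>i\<in>I. emeasure lborel (A i))"
  using product_sigma_finite.emeasure_PiM[OF product_sigma_finite_lborel assms(1), of A] assms(2) by simp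

lemma sets_cube [measurable]: "finite I \<Longrightarrow> cube I \<in> sets (lebP I)"
  unfolding cube_def by (rule sets_PiM_I_finite) auto

lemma emeasure_cube: "finite I \<Longrightarrow> emeasure (lebP I) (cube I) = 1"
  unfolding cube_def by (subst emeasure_lebP_PiE) auto

lemma measure_cube: "finite I \<Longrightarrow> measure (lebP I) (cube I) = 1"
  by (simp add: measure_def emeasure_cube)

lemma integrable_indicator_cube: "finite I \<Longrightarrow> integrable (lebP I) (indicator (cube I) :: _ \<Rightarrow> real)"
  by (auto simp: emeasure_cube less_top[symmetric])

text \<open>
  Passing from the completed measure to the product measure is necessary because the theorem of
  Fubini is applied to the latter. As \<open>f\<close> is only assumed to agree almost everywhere with a
  measurable function, its measurability for the completion is part of the conclusion.
\<close>

lemma integral_completion_AE: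
  fixes f g :: "'a \<Rightarrow> real"
  assumes g: "g \<in> borel_measurable M" and ae: "AE x in M. f x = g x"
  shows "f \<in> borel_measurable (completion M)" "integral\<^sup>L (completion M) f = integral\<^sup>L M g"
    "integrable (completion M) f \<longleftrightarrow> integrable M g"
proof -
  have gc: "g \<in> borel_measurable (completion M)"
    using g by (rule measurable_completion)
  have ae': "AE x in completion M. f x = g x"
    using ae by (rule AE_completion)
  show f: "f \<in> borel_measurable (completion M)"
  proof (rule measurableI)
    fix A :: "real set" assume "A \<in> sets borel"
    with gc have "g -` A \<inter> space (completion M) \<in> sets (completion M)" by (rule measurable_sets)
    then show "f -` A \<inter> space (completion M) \<in> sets (completion M)"
    proof (rule completion.in_sets_AE[rotated])
      show "AE x in completion M. x \<in> g -` A \<inter> space (completion M) \<longleftrightarrow> x \<in> f -` A \<inter> space (completion M)"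
        using ae' by eventually_elim auto
    qed auto
  qed simp
  show "integral\<^sup>L (completion M) f = integral\<^sup>L M g"
    using integral_cong_AE[OF f gc ae'] integral_completion[OF g] by simp
  show "integrable (completion M) f \<longleftrightarrow> integrable M g"
    using integrable_cong_AE[OF f gc ae'] integrable_completion[OF g] by simp
qed

lemma integrable_mult_bounded:
  fixes g h :: "'a \<Rightarrow> real"
  assumes g: "integrable M g" and h [measurable]: "h \<in> borel_measurable M" and c: "\<And>x. \<bar>h x\<bar> \<le> c"
  shows "integrable M (\<lambda>x. g x * h x)"
proof (rule Bochner_Integration.integrable_bound)
  show "integrable M (\<lambda>x. g x * c)" using g by simp
  have [measurable]: "g \<in> borel_measurable M" using g by simp
  show "(\<lambda>x. g x * h x) \<in> borel_measurable M" by measurable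
  show "AE x in M. norm (g x * h x) \<le> norm (g x * c)"
  proof (intro AE_I2)
    fix x
    have "\<bar>h x\<bar> \<le> \<bar>c\<bar>" using c[of x] by linarith
    then show "norm (g x * h x) \<le> norm (g x * c)" by (simp add: abs_mult mult_left_mono)
  qed
qed

lemma integrable_of_square:
  fixes g :: "_ \<Rightarrow> real"
  assumes "finite I" and [measurable]: "g \<in> borel_measurable (lebP I)"
    and "\<And>x. x \<in> space (lebP I) \<Longrightarrow> x \<notin> cube I \<Longrightarrow> g x = 0" "integrable (lebP I) (\<lambda>x. (g x)\<^sup>2)"
  shows "integrable (lebP I) g"
proof (rule Bochner_Integration.integrable_bound)
  show "integrable (lebP I) (\<lambda>x. indicator (cube I) x + (g x)\<^sup>2)"
    using assms(4) integrable_indicator_cube[OF assms(1)] by (rule Bochner_Integration.integrable_add[rotated])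
  have "\<bar>g x\<bar> \<le> indicator (cube I) x + (g x)\<^sup>2" if "x \<in> space (lebP I)" for x
  proof (cases "x \<in> cube I")
    case True
    have "0 \<le> (\<bar>g x\<bar> - 1)\<^sup>2" "0 \<le> (g x)\<^sup>2" by simp_all
    with True show ?thesis by (simp add: power2_diff)
  qed (simp add: assms(3) that)
  then show "AE x in lebP I. norm (g x) \<le> norm (indicator (cube I) x + (g x)\<^sup>2)"
    by (intro AE_I2) (auto intro: order_trans[OF _ abs_ge_self])
qed measurable

text \<open>
  The Cauchy-Schwarz inequality against the constant 1 on a set of measure 1: expand the integral
  of \<open>(g - m)\<^sup>2 \<ge> 0\<close> over the cube, \<open>m\<close> being the mean of \<open>g\<close>.
\<close>

lemma square_integral_le:
  fixes g :: "_ \<Rightarrow> real"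
  assumes "finite I" "g \<in> borel_measurable (lebP I)"
    "\<And>x. x \<in> space (lebP I) \<Longrightarrow> x \<notin> cube I \<Longrightarrow> g x = 0" "integrable (lebP I) (\<lambda>x. (g x)\<^sup>2)"
  shows "(\<integral>x. g x \<partial>lebP I)\<^sup>2 \<le> (\<integral>x. (g x)\<^sup>2 \<partial>lebP I)"
proof -
  let ?m = "\<integral>x. g x \<partial>lebP I"
  note int = integrable_of_square[OF assms] integrable_indicator_cube[OF assms(1)] assms(4)
  have "0 \<le> (\<integral>x. (g x - ?m * indicator (cube I) x)\<^sup>2 \<partial>lebP I)" by simp
  also have "(\<integral>x. (g x - ?m * indicator (cube I) x)\<^sup>2 \<partial>lebP I) =
      (\<integral>x. (g x)\<^sup>2 - 2 * ?m * g x + ?m\<^sup>2 * indicator (cube I) x \<partial>lebP I)"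
    using assms(3) by (intro Bochner_Integration.integral_cong) (auto simp: indicator_def power2_diff)
  also have "(\<integral>x. (g x)\<^sup>2 - 2 * ?m * g x + ?m\<^sup>2 * indicator (cube I) x \<partial>lebP I) =
      (\<integral>x. (g x)\<^sup>2 \<partial>lebP I) - 2 * ?m * ?m + ?m\<^sup>2 * measure (lebP I) (cube I)"
    using int assms(1) by (simp add: sets.Int_space_eq2)
  finally show ?thesis
    by (simp add: measure_cube[OF assms(1)] power2_eq_square)
qed

text \<open>
  The values of \<open>f\<close> outside the cube are irrelevant, so a representative can be taken that vanishes
  there; integrals over the cube then become integrals over the whole space.
\<close>

lemma square_integrable_representative:
  assumes "square_integrable s f"
  shows "\<exists>g. g \<in> borel_measurable (lebP {1..s}) \<and> (\<forall>x. x \<notin> cube {1..s} \<longrightarrow> g x = 0) \<and>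
    (AE x in lebP {1..s}. x \<in> cube {1..s} \<longrightarrow> f x = g x) \<and> integrable (lebP {1..s}) (\<lambda>x. (g x)\<^sup>2)"
proof -
  let ?C = "cube {1..s}"
  have "(\<lambda>x. indicator ?C x *\<^sub>R f x) \<in> borel_measurable (completion (lebP {1..s}))"
    and int: "integrable (completion (lebP {1..s})) (\<lambda>x. indicator ?C x *\<^sub>R (f x)\<^sup>2)"
    using assms by (auto simp: square_integrable_def leb_def set_borel_measurable_def set_integrable_def)
  from completion_ex_borel_measurable_real[OF this(1)] obtain h where
    [measurable]: "h \<in> borel_measurable (lebP {1..s})" and h: "AE x in lebP {1..s}. indicator ?C x *\<^sub>R f x = h x"
    by auto
  define g where "g x = indicator ?C x * h x" for x
  have [measurable]: "g \<in> borel_measurable (lebP {1..s})"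
    unfolding g_def by measurable
  have ae: "AE x in lebP {1..s}. x \<in> ?C \<longrightarrow> f x = g x"
    using h by eventually_elim (auto simp: g_def)
  have "AE x in lebP {1..s}. indicator ?C x *\<^sub>R (f x)\<^sup>2 = (g x)\<^sup>2"
    using ae by eventually_elim (auto simp: g_def indicator_def)
  then have "integrable (completion (lebP {1..s})) (\<lambda>x. indicator ?C x *\<^sub>R (f x)\<^sup>2) \<longleftrightarrow>
      integrable (lebP {1..s}) (\<lambda>x. (g x)\<^sup>2)"
    by (rule integral_completion_AE(3)[rotated]) measurable
  with int have sq: "integrable (lebP {1..s}) (\<lambda>x. (g x)\<^sup>2)" by blast
  have "\<forall>x. x \<notin> ?C \<longrightarrow> g x = 0" by (simp add: g_def)
  then show ?thesis
    using \<open>g \<in> borel_measurable (lebP {1..s})\<close> ae sq by blast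
qed

lemma set_integral_representative:
  fixes f g \<psi> :: "(nat \<Rightarrow> real) \<Rightarrow> real"
  assumes [measurable]: "g \<in> borel_measurable (lebP I)" "\<psi> \<in> borel_measurable (lebP I)" "A \<in> sets (lebP I)"
    and "AE x in lebP I. x \<in> cube I \<longrightarrow> f x = g x" "A \<subseteq> cube I"
  shows "(LINT x:A|leb I. f x * \<psi> x) = (\<integral>x. g x * \<psi> x * indicator A x \<partial>lebP I)"
  unfolding leb_def set_lebesgue_integral_def
proof (rule integral_completion_AE(2))
  show "AE x in lebP I. indicator A x *\<^sub>R (f x * \<psi> x) = g x * \<psi> x * indicator A x"
    using assms(4) by eventually_elim (use assms(5) in \<open>auto simp: indicator_def\<close>)
qed measurable

lemma merge_mem_cube:
  assumes "I \<inter> J = {}" "x \<in> space (lebP I)" "y \<in> space (lebP J)"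
  shows "merge I J (x, y) \<in> cube (I \<union> J) \<longleftrightarrow> x \<in> cube I \<and> y \<in> cube J"
  using assms by (simp add: cube_def space_PiM PiE_iff ball_Un cong: ball_cong)

text \<open>
  Integrating out the coordinates in \<open>J\<close> leaves the marginal \<open>F\<close> of \<open>g\<close>, and the right-hand side is
  \<open>M\<close> times its \<open>L\<^sup>2\<close> norm. For almost every \<open>x\<close> the section of \<open>g\<close> agrees almost everywhere with
  that of its representative, which identifies the iterated integral over the completions with the
  one to which the theorem of Fubini applies.
\<close>

lemma marginal_bound:
  fixes g g\<^sub>0 :: "(nat \<Rightarrow> real) \<Rightarrow> real"
  assumes fin: "finite I" "finite J" and IJ: "I \<inter> J = {}"
    and g0[measurable]: "g\<^sub>0 \<in> borel_measurable (lebP (I \<union> J))"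
    and supp: "\<And>x. x \<notin> cube (I \<union> J) \<Longrightarrow> g\<^sub>0 x = 0"
    and ae: "AE x in lebP (I \<union> J). x \<in> cube (I \<union> J) \<longrightarrow> g x = g\<^sub>0 x"
    and sq: "integrable (lebP (I \<union> J)) (\<lambda>x. (g\<^sub>0 x)\<^sup>2)"
    and psi[measurable]: "\<psi> \<in> borel_measurable (lebP I)" and M: "\<And>x. \<bar>\<psi> x\<bar> \<le> M"
  shows "\<bar>\<integral>z. g\<^sub>0 z * \<psi> (restrict z I) \<partial>lebP (I \<union> J)\<bar>
    \<le> M * sqrt (LINT x:cube I|leb I. \<bar>LINT y:cube J|leb J. g (merge I J (x, y))\<bar>\<^sup>2)"
proof -
  interpret P: product_sigma_finite "\<lambda>_::nat. lborel :: real measure"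
    by (rule product_sigma_finite_lborel)
  interpret SI: sigma_finite_measure "lebP I" by (rule sigma_finite_lebP[OF fin(1)])
  interpret SJ: sigma_finite_measure "lebP J" by (rule sigma_finite_lebP[OF fin(2)])
  interpret PP: pair_sigma_finite "lebP I" "lebP J" ..
  let ?mg = "\<lambda>x y. merge I J (x, y)"
  define F where "F x = (\<integral>y. g\<^sub>0 (?mg x y) \<partial>lebP J)" for x
  have fK: "finite (I \<union> J)" using fin by simp
  have M0: "M \<ge> 0" using M[of undefined] by linarith
  have distr: "distr (lebP I \<Otimes>\<^sub>M lebP J) (lebP (I \<union> J)) (merge I J) = lebP (I \<union> J)"
    by (rule P.distr_merge[OF IJ fin])
  have lift: "integrable (lebP I \<Otimes>\<^sub>M lebP J) (\<lambda>z. h (merge I J z))"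
    if "integrable (lebP (I \<union> J)) h" for h :: "_ \<Rightarrow> real"
    using that distr by (intro integrable_distr[OF measurable_merge]) simp
  have Fm [measurable]: "F \<in> borel_measurable (lebP I)"
    unfolding F_def by measurable
  have Fsupp: "F x = 0" if "x \<notin> cube I" "x \<in> space (lebP I)" for x
  proof -
    have "F x = (\<integral>y. 0 \<partial>lebP J)"
      unfolding F_def using that merge_mem_cube[OF IJ] supp by (intro Bochner_Integration.integral_cong) auto
    then show ?thesis by simp
  qed
  have le: "AE x in lebP I. (F x)\<^sup>2 \<le> (\<integral>y. (g\<^sub>0 (?mg x y))\<^sup>2 \<partial>lebP J)"
    using PP.AE_integrable_fst'[OF lift[OF sq]] AE_space
  proof eventually_elim
    case (elim x)
    then have [measurable]: "(\<lambda>y. g\<^sub>0 (?mg x y)) \<in> borel_measurable (lebP J)"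
      by measurable
    show ?case
      unfolding F_def
      by (rule square_integral_le) (use elim supp merge_mem_cube[OF IJ] fin in auto)
  qed
  have sqF: "integrable (lebP I) (\<lambda>x. (F x)\<^sup>2)"
  proof (rule Bochner_Integration.integrable_bound[OF PP.integrable_fst'[OF lift[OF sq]]])
    show "AE x in lebP I. norm ((F x)\<^sup>2) \<le> norm (\<integral>y. (g\<^sub>0 (?mg x y))\<^sup>2 \<partial>lebP J)"
      using le by eventually_elim simp
  qed measurable
  have intF: "integrable (lebP I) F"
    by (rule integrable_of_square[OF fin(1) Fm Fsupp sqF])
  have F_eq: "AE x in lebP I. indicator (cube I) x *\<^sub>R \<bar>LINT y:cube J|leb J. g (?mg x y)\<bar>\<^sup>2 = (F x)\<^sup>2"
  proof -
    have "AE z in lebP I \<Otimes>\<^sub>M lebP J. merge I J z \<in> cube (I \<union> J) \<longrightarrow> g (merge I J z) = g\<^sub>0 (merge I J z)"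
      by (rule AE_distrD[OF measurable_merge]) (subst distr, rule ae)
    from PP.AE_pair[OF this] show ?thesis
      using AE_space
    proof eventually_elim
      case (elim x)
      show ?case
      proof (cases "x \<in> cube I")
        case True
        have "AE y in lebP J. indicator (cube J) y *\<^sub>R g (?mg x y) = g\<^sub>0 (?mg x y)"
          using elim(1) AE_space
        proof eventually_elim
          case (elim y)
          with True \<open>x \<in> space (lebP I)\<close> show ?case
            using merge_mem_cube[OF IJ, of x y] supp[of "?mg x y"] by (cases "y \<in> cube J") auto
        qed
        moreover have "(\<lambda>y. g\<^sub>0 (?mg x y)) \<in> borel_measurable (lebP J)"
          using elim(2) by measurable
        ultimately have "(LINT y:cube J|leb J. g (?mg x y)) = F x"
          unfolding F_def leb_def set_lebesgue_integral_def by (intro integral_completion_AE(2))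
        then show ?thesis using True by simp
      qed (use Fsupp elim in auto)
    qed
  qed
  have T: "(LINT x:cube I|leb I. \<bar>LINT y:cube J|leb J. g (?mg x y)\<bar>\<^sup>2) = (\<integral>x. (F x)\<^sup>2 \<partial>lebP I)"
    unfolding leb_def[of I] set_lebesgue_integral_def[of "completion (lebP I)"]
    by (rule integral_completion_AE(2)[OF _ F_eq]) measurable
  have intg: "integrable (lebP (I \<union> J)) g\<^sub>0"
    by (rule integrable_of_square[OF fK g0 supp sq])
  have [measurable]: "(\<lambda>z. restrict z I) \<in> lebP (I \<union> J) \<rightarrow>\<^sub>M lebP I"
    by (rule measurable_restrict_subset) auto
  have "integrable (lebP (I \<union> J)) (\<lambda>z. g\<^sub>0 z * \<psi> (restrict z I))"
    by (rule integrable_mult_bounded[OF intg _ M]) measurable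
  from P.product_integral_fold[OF IJ fin this]
  have "(\<integral>z. g\<^sub>0 z * \<psi> (restrict z I) \<partial>lebP (I \<union> J)) =
      (\<integral>x. (\<integral>y. g\<^sub>0 (?mg x y) * \<psi> (restrict x I) \<partial>lebP J) \<partial>lebP I)"
    by (simp add: IJ)
  also have "\<dots> = (\<integral>x. F x * \<psi> x \<partial>lebP I)"
    by (intro Bochner_Integration.integral_cong) (auto simp: F_def space_PiM PiE_def extensional_restrict)
  also have "\<bar>\<dots>\<bar> \<le> (\<integral>x. M * \<bar>F x\<bar> \<partial>lebP I)"
  proof (rule order_trans[OF integral_abs_bound integral_mono'])
    show "integrable (lebP I) (\<lambda>x. M * \<bar>F x\<bar>)" using intF by simp
    show "\<bar>F x * \<psi> x\<bar> \<le> M * \<bar>F x\<bar>" for x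
      using mult_left_mono[OF M[of x], of "\<bar>F x\<bar>"] by (simp add: abs_mult mult.commute)
  qed (use M0 in auto)
  also have "\<dots> = M * (\<integral>x. \<bar>F x\<bar> \<partial>lebP I)" by simp
  also have "\<dots> \<le> M * sqrt (\<integral>x. (F x)\<^sup>2 \<partial>lebP I)"
  proof (rule mult_left_mono[OF _ M0])
    have "(\<integral>x. \<bar>F x\<bar> \<partial>lebP I)\<^sup>2 \<le> (\<integral>x. \<bar>F x\<bar>\<^sup>2 \<partial>lebP I)"
      by (rule square_integral_le) (use fin Fsupp sqF in auto)
    then show "(\<integral>x. \<bar>F x\<bar> \<partial>lebP I) \<le> sqrt (\<integral>x. (F x)\<^sup>2 \<partial>lebP I)"
      by (intro real_le_rsqrt) simp
  qed
  finally show ?thesis by (simp only: T)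
qed

section \<open>Integrals over boxes and the Sobolev norm\<close>

lemma AE_coordinate_neq:
  assumes "finite I" "i \<in> I"
  shows "AE z in lebP I. z i \<noteq> c"
proof -
  let ?N = "\<Pi>\<^sub>E j\<in>I. if j = i then {c} else UNIV"
  have "emeasure (lebP I) ?N = (\<Prod>j\<in>I. emeasure lborel (if j = i then {c} else UNIV))"
    using assms(1) by (rule emeasure_lebP_PiE) auto
  also have "\<dots> = 0"
    using assms by (intro prod_zero) auto
  finally have "?N \<in> null_sets (lebP I)"
    using assms(1) by (auto intro!: null_setsI sets_PiM_I_finite)
  then show ?thesis
    by (rule AE_I') (use assms(2) in \<open>auto simp: space_PiM PiE_iff extensional_def\<close>)
qed

lemma measurable_prod_coordinates:
  assumes "S \<subseteq> I" "\<And>i. i \<in> S \<Longrightarrow> h i \<in> borel_measurable borel"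
  shows "(\<lambda>z. \<Prod>i\<in>S. h i (z i) :: real) \<in> borel_measurable (lebP I)"
proof (rule borel_measurable_prod)
  fix i assume "i \<in> S"
  with assms have "(\<lambda>z. z i) \<in> lebP I \<rightarrow>\<^sub>M borel" "h i \<in> borel_measurable borel"
    using measurable_component_singleton[of i I "\<lambda>_. lborel :: real measure"] by auto
  then show "(\<lambda>z. h i (z i)) \<in> borel_measurable (lebP I)"
    by (rule measurable_compose)
qed

lemma test1_measurable: "test1 \<phi> \<Longrightarrow> \<phi> \<in> borel_measurable borel"
  by (rule borel_measurable_continuous_onI[OF test1_continuous])

lemma tensor_measurable: "(\<And>i. test1 (\<zeta> i)) \<Longrightarrow> tensor s \<zeta> \<in> borel_measurable (lebP {1..s})"
  unfolding tensor_def[abs_def] by (rule measurable_prod_coordinates) (auto intro: test1_measurable)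

lemma test1_bounded:
  assumes "test1 \<phi>" shows "\<exists>c. \<forall>x. \<bar>\<phi> x\<bar> \<le> c"
proof -
  have "bounded (\<phi> ` {0..1})"
    by (intro compact_imp_bounded compact_continuous_image test1_continuous assms) auto
  then obtain c where "\<forall>y\<in>\<phi> ` {0..1}. \<bar>y\<bar> \<le> c"
    unfolding bounded_iff real_norm_def by blast
  then have c: "\<bar>\<phi> x\<bar> \<le> c" if "x \<in> {0..1}" for x using that by blast
  have "\<phi> x = 0" if "x \<notin> {0..1}" for x
    using assms that unfolding test1_def by force
  moreover have "c \<ge> 0" using c[of 0] by simp
  ultimately have "\<bar>\<phi> x\<bar> \<le> c" for x
    using c[of x] by (cases "x \<in> {0..1}") auto
  then show ?thesis by blast
qed

lemma tensor_bounded: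
  assumes "\<And>i. test1 (\<zeta> i)" shows "\<exists>c. \<forall>x. \<bar>tensor s \<zeta> x\<bar> \<le> c"
proof -
  obtain c where c: "\<And>i x. \<bar>\<zeta> i x\<bar> \<le> c i"
    using test1_bounded[OF assms] by metis
  have "\<bar>tensor s \<zeta> x\<bar> \<le> (\<Prod>i\<in>{1..s}. c i)" for x
    unfolding tensor_def abs_prod using c by (intro prod_mono) auto
  then show ?thesis by blast
qed

lemma abs_prod_le_power:
  fixes f :: "'a \<Rightarrow> real"
  assumes "\<And>i. i \<in> A \<Longrightarrow> \<bar>f i\<bar> \<le> M" "1 \<le> M" "card A \<le> s"
  shows "\<bar>prod f A\<bar> \<le> M ^ s"
proof -
  have "\<bar>prod f A\<bar> \<le> (\<Prod>i\<in>A. M)"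
    unfolding abs_prod using assms by (intro prod_mono) auto
  also have "\<dots> \<le> M ^ s" using assms by (simp add: power_increasing)
  finally show ?thesis .
qed

text \<open>
  Dominated convergence; convergence fails only on the hyperplanes where a coordinate equals the
  left end point. The second limit will show that replacing \<open>\<eta>\<close> by 1 costs nothing in the limit,
  even when the factor that multiplies it varies with \<open>k\<close> in an uncontrolled but bounded way.
\<close>

lemma bump_product_integral_tendsto:
  assumes fin: "finite I" and G: "integrable (lebP I) G" and S: "S \<subseteq> I"
    and ab: "\<And>i. 0 \<le> a i" "\<And>i. b i \<le> 1"
  shows "(\<lambda>k. \<integral>z. G z * (\<Prod>i\<in>S. bump (a i) (b i) k (z i)) \<partial>lebP I)
      \<longlonglongrightarrow> (\<integral>z. G z * (\<Prod>i\<in>S. indicator {a i..<b i} (z i)) \<partial>lebP I)"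
    and "(\<lambda>k. \<integral>z. \<bar>G z\<bar> * \<bar>(\<Prod>i\<in>S. bump (a i) (b i) k (z i)) -
      (\<Prod>i\<in>S. indicator {a i..<b i} (z i))\<bar> \<partial>lebP I) \<longlonglongrightarrow> 0"
proof -
  let ?W = "\<lambda>k z. \<Prod>i\<in>S. bump (a i) (b i) k (z i)"
  let ?V = "\<lambda>z. \<Prod>i\<in>S. indicator {a i..<b i} (z i) :: real"
  have [measurable]: "?W k \<in> borel_measurable (lebP I)" for k
    using ab by (intro measurable_prod_coordinates[OF S] test1_measurable test1_bump) auto
  have [measurable]: "?V \<in> borel_measurable (lebP I)"
    by (intro measurable_prod_coordinates[OF S]) auto
  have W1: "\<bar>?W k z\<bar> \<le> 1" for k z
    using bump_bounds by (auto simp: abs_prod intro!: prod_le_1)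
  have V1: "\<bar>?V z\<bar> \<le> 1" for z
    by (auto simp: abs_prod intro!: prod_le_1)
  have "AE z in lebP I. \<forall>i\<in>S. z i \<noteq> a i"
    using S fin by (intro AE_finite_allI AE_coordinate_neq) (auto intro: finite_subset)
  then have lim: "AE z in lebP I. (\<lambda>k. ?W k z) \<longlonglongrightarrow> ?V z"
    by eventually_elim (intro tendsto_prod bump_tendsto, blast)
  have [measurable]: "G \<in> borel_measurable (lebP I)" using G by simp
  show "(\<lambda>k. \<integral>z. G z * ?W k z \<partial>lebP I) \<longlonglongrightarrow> (\<integral>z. G z * ?V z \<partial>lebP I)"
  proof (rule integral_dominated_convergence[where w = "\<lambda>z. \<bar>G z\<bar>"])
    show "AE z in lebP I. (\<lambda>k. G z * ?W k z) \<longlonglongrightarrow> G z * ?V z"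
      using lim by eventually_elim (intro tendsto_mult tendsto_const)
    show "AE z in lebP I. norm (G z * ?W k z) \<le> \<bar>G z\<bar>" for k
      by (intro AE_I2) (simp only: real_norm_def abs_mult mult_left_le W1 abs_ge_zero)
  qed (use G in auto)
  have "(\<lambda>k. \<integral>z. \<bar>G z\<bar> * \<bar>?W k z - ?V z\<bar> \<partial>lebP I) \<longlonglongrightarrow> (\<integral>z. 0 \<partial>lebP I)"
  proof (rule integral_dominated_convergence[where w = "\<lambda>z. \<bar>G z\<bar> * 2"])
    show "AE z in lebP I. (\<lambda>k. \<bar>G z\<bar> * \<bar>?W k z - ?V z\<bar>) \<longlonglongrightarrow> 0"
      using lim by eventually_elim (auto intro!: tendsto_mult_right_zero tendsto_rabs_zero simp: LIM_zero_iff)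
    show "AE z in lebP I. norm (\<bar>G z\<bar> * \<bar>?W k z - ?V z\<bar>) \<le> \<bar>G z\<bar> * 2" for k
    proof (intro AE_I2)
      fix z
      have "\<bar>?W k z - ?V z\<bar> \<le> 2" using W1[of k z] V1[of z] by linarith
      then show "norm (\<bar>G z\<bar> * \<bar>?W k z - ?V z\<bar>) \<le> \<bar>G z\<bar> * 2"
        by (simp add: abs_mult mult_left_mono)
    qed
  qed (use G in auto)
  then show "(\<lambda>k. \<integral>z. \<bar>G z\<bar> * \<bar>?W k z - ?V z\<bar> \<partial>lebP I) \<longlonglongrightarrow> 0" by simp
qed

text \<open>
  Multiply out the one-dimensional expansions; \<open>\<tau> i\<close> records which summand is taken in coordinate
  \<open>i\<close>. The remainder \<open>\<psi>\<close> occurs precisely where \<open>\<tau> i = n\<close>.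
\<close>

lemma tensor_expand:
  assumes "\<And>i. test1 (\<phi> i)" "\<And>i x. \<bar>\<phi> i x\<bar> \<le> 1"
    and "test1 \<eta>" "\<And>x. \<bar>\<eta> x\<bar> \<le> 1" "broad \<eta>"
  shows "\<exists>d \<psi>. (\<forall>i. test1 (\<psi> i)) \<and> (\<forall>i x. \<bar>\<psi> i x\<bar> \<le> 5 ^ n) \<and> (\<forall>i m. \<bar>d i m\<bar> \<le> 5 ^ n) \<and>
    (\<forall>x. tensor s \<phi> x = (\<Sum>\<tau>\<in>{1..s} \<rightarrow>\<^sub>E {0..n}. (\<Prod>i\<in>{1..s}. d i (\<tau> i)) *
      tensor s (\<lambda>i. (deriv ^^ \<tau> i) (if \<tau> i = n then \<psi> i else \<eta>)) x))"
proof -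
  have "\<forall>i. \<exists>c \<psi>. test1 \<psi> \<and> (\<forall>x. \<bar>\<psi> x\<bar> \<le> 5 ^ n) \<and> (\<forall>m. \<bar>c m\<bar> \<le> 5 ^ n) \<and>
      \<phi> i = (\<lambda>x. (\<Sum>m<n. c m * (deriv ^^ m) \<eta> x) + (deriv ^^ n) \<psi> x)"
    using assms by (intro allI test1_expand)
  then obtain c where "\<forall>i. \<exists>\<psi>. test1 \<psi> \<and> (\<forall>x. \<bar>\<psi> x\<bar> \<le> 5 ^ n) \<and> (\<forall>m. \<bar>c i m\<bar> \<le> 5 ^ n) \<and>
      \<phi> i = (\<lambda>x. (\<Sum>m<n. c i m * (deriv ^^ m) \<eta> x) + (deriv ^^ n) \<psi> x)"
    by (rule choice[THEN exE])
  then obtain \<psi> where "\<forall>i. test1 (\<psi> i) \<and> (\<forall>x. \<bar>\<psi> i x\<bar> \<le> 5 ^ n) \<and> (\<forall>m. \<bar>c i m\<bar> \<le> 5 ^ n) \<and>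
      \<phi> i = (\<lambda>x. (\<Sum>m<n. c i m * (deriv ^^ m) \<eta> x) + (deriv ^^ n) (\<psi> i) x)"
    by (rule choice[THEN exE])
  then have c: "\<And>i. test1 (\<psi> i)" "\<And>i x. \<bar>\<psi> i x\<bar> \<le> 5 ^ n" "\<And>i m. \<bar>c i m\<bar> \<le> (5::real) ^ n"
    "\<And>i. \<phi> i = (\<lambda>x. (\<Sum>m<n. c i m * (deriv ^^ m) \<eta> x) + (deriv ^^ n) (\<psi> i) x)"
    by blast+
  \<comment> \<open>The remainder is the summand of index \<open>n\<close>, with coefficient 1.\<close>
  define d where "d i m = (if m = n then 1 else c i m)" for i m
  have \<phi>: "\<phi> i x = (\<Sum>m\<in>{0..n}. d i m * (deriv ^^ m) (if m = n then \<psi> i else \<eta>) x)" for i x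
  proof -
    have "(\<Sum>m\<in>{0..n}. d i m * (deriv ^^ m) (if m = n then \<psi> i else \<eta>) x) =
        (\<Sum>m<n. d i m * (deriv ^^ m) (if m = n then \<psi> i else \<eta>) x) + (deriv ^^ n) (\<psi> i) x"
      by (simp add: atLeast0AtMost lessThan_Suc_atMost[symmetric] d_def)
    also have "(\<Sum>m<n. d i m * (deriv ^^ m) (if m = n then \<psi> i else \<eta>) x) = (\<Sum>m<n. c i m * (deriv ^^ m) \<eta> x)"
      by (rule sum.cong) (auto simp: d_def)
    finally show ?thesis by (subst c(4)) simp
  qed
  have "\<bar>d i m\<bar> \<le> 5 ^ n" for i m using c(3)[of i m] by (auto simp: d_def)
  moreover have "tensor s \<phi> x = (\<Sum>\<tau>\<in>{1..s} \<rightarrow>\<^sub>E {0..n}. (\<Prod>i\<in>{1..s}. d i (\<tau> i)) *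
      tensor s (\<lambda>i. (deriv ^^ \<tau> i) (if \<tau> i = n then \<psi> i else \<eta>)) x)" for x
    unfolding tensor_def \<phi> by (subst prod_sum_PiE) (auto simp: prod.distrib)
  ultimately show ?thesis
    using c(1,2) by (intro exI[of _ d] exI[of _ \<psi>]) blast
qed

lemma n_smooth_imp_square_integrable: "n_smooth s n f \<Longrightarrow> square_integrable s f"
proof -
  assume "n_smooth s n f"
  moreover have "(\<lambda>i\<in>{1..s}. 0) \<in> {1..s} \<rightarrow>\<^sub>E {0..n}" by auto
  ultimately obtain g where "has_L2_weak_deriv s (\<lambda>i\<in>{1..s}. 0) f g"
    unfolding n_smooth_def by blast
  then show ?thesis by (simp add: has_L2_weak_deriv_def)
qed

text \<open>
  The Sobolev norm is indexed by pairs of a set \<open>u\<close> and a multi-index below \<open>n\<close> on its complement.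
  Such pairs correspond to multi-indices \<open>\<tau>\<close> with values up to \<open>n\<close>, the set \<open>u\<close> being the places
  where the value \<open>n\<close> is attained.
\<close>

definition sobolev_term :: "nat \<Rightarrow> nat \<Rightarrow> ((nat \<Rightarrow> real) \<Rightarrow> real) \<Rightarrow> (nat \<Rightarrow> nat) \<Rightarrow> real" where
  "sobolev_term s n f \<tau> = (let u = {i\<in>{1..s}. \<tau> i = n} in
     sqrt (LINT x:cube u|leb u. \<bar>LINT y:cube ({1..s} - u)|leb ({1..s} - u).
       weak_deriv s \<tau> f (merge u ({1..s} - u) (x, y))\<bar>\<^sup>2))"

lemma sobolev_term_le:
  assumes "\<tau> \<in> {1..s} \<rightarrow>\<^sub>E {0..n}"
  shows "sobolev_term s n f \<tau> \<le> sobolev_norm s n f"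
proof -
  define T where "T u \<tau> = (LINT x:cube u|leb u. \<bar>LINT y:cube ({1..s} - u)|leb ({1..s} - u).
    weak_deriv s (\<lambda>i\<in>{1..s}. if i \<in> u then n else \<tau> i) f (merge u ({1..s} - u) (x, y))\<bar>\<^sup>2)" for u \<tau>
  have T0: "T u \<tau> \<ge> 0" for u \<tau>
    unfolding T_def set_lebesgue_integral_def by (intro Bochner_Integration.integral_nonneg) auto
  define u where "u = {i\<in>{1..s}. \<tau> i = n}"
  define \<sigma> where "\<sigma> = restrict \<tau> ({1..s} - u)"
  have "\<tau> i < n" if "i \<in> {1..s} - u" for i
    using PiE_mem[OF assms, of i] that by (auto simp: u_def)
  then have \<sigma>: "\<sigma> \<in> ({1..s} - u) \<rightarrow>\<^sub>E {0..<n}" by (auto simp: \<sigma>_def)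
  have "(\<lambda>i\<in>{1..s}. if i \<in> u then n else \<sigma> i) = \<tau>"
    using assms by (auto simp: fun_eq_iff \<sigma>_def u_def PiE_iff extensional_def)
  then have "sobolev_term s n f \<tau> = sqrt (T u \<sigma>)"
    unfolding sobolev_term_def Let_def T_def u_def[symmetric] by (simp only:)
  also have "\<dots> \<le> sobolev_norm s n f"
    unfolding sobolev_norm_def T_def[symmetric]
  proof (rule real_sqrt_le_mono)
    have "T u \<sigma> \<le> (\<Sum>\<tau>\<in>({1..s} - u) \<rightarrow>\<^sub>E {0..<n}. T u \<tau>)"
      using \<sigma> T0 by (intro member_le_sum finite_PiE) auto
    also have "\<dots> \<le> (\<Sum>u\<in>Pow {1..s}. \<Sum>\<tau>\<in>({1..s} - u) \<rightarrow>\<^sub>E {0..<n}. T u \<tau>)"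
      using T0 by (intro member_le_sum[of u "Pow {1..s}" "\<lambda>u. \<Sum>\<tau>\<in>({1..s} - u) \<rightarrow>\<^sub>E {0..<n}. T u \<tau>"] sum_nonneg)
        (auto simp: u_def)
    finally show "T u \<sigma> \<le> (\<Sum>u\<in>Pow {1..s}. \<Sum>\<tau>\<in>({1..s} - u) \<rightarrow>\<^sub>E {0..<n}. T u \<tau>)" .
  qed
  finally show ?thesis .
qed

text \<open>
  With \<open>\<phi>\<^sub>k = bump (a i) (b i) k\<close> and \<open>\<eta>\<^sub>k = bump 0 1 k\<close> the expansion is made for every \<open>k\<close>
  separately. The remainders \<open>\<psi>\<close> vary with \<open>k\<close> and need not converge; only their bound enters,
  and the limit is taken in the inequality alone. One factor \<open>(5^n)^s\<close> stems from the coefficients, the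
  other one from the remainders.
\<close>

lemma box_integral_bound:
  assumes f: "n_smooth s n f" and ab: "\<And>i. 0 \<le> a i" "\<And>i. b i \<le> 1"
  shows "\<bar>LINT x:(\<Pi>\<^sub>E i\<in>{1..s}. {a i..<b i})|leb {1..s}. f x\<bar>
    \<le> real (card ({1..s} \<rightarrow>\<^sub>E {0..n})) * ((5 ^ n) ^ s)\<^sup>2 * sobolev_norm s n f"
proof -
  let ?I = "{1..s}" and ?T = "{1..s} \<rightarrow>\<^sub>E {0..n}" and ?B = "\<Pi>\<^sub>E i\<in>{1..s}. {a i..<b i}"
  let ?M = "(5 ^ n) ^ s :: real"
  let ?u = "\<lambda>\<tau>. {i\<in>?I. \<tau> i = n}"
  have finT: "finite ?T" by (intro finite_PiE) auto
  have weak: "has_L2_weak_deriv s \<tau> f (weak_deriv s \<tau> f)" if "\<tau> \<in> ?T" for \<tau>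
    using f that unfolding n_smooth_def weak_deriv_def by (intro someI_ex[of "has_L2_weak_deriv s \<tau> f"]) blast
  have sqf: "square_integrable s f" by (rule n_smooth_imp_square_integrable[OF f])
  obtain f0 where f0[measurable]: "f0 \<in> borel_measurable (lebP ?I)" "\<And>x. x \<notin> cube ?I \<Longrightarrow> f0 x = 0"
    and f0_ae: "AE x in lebP ?I. x \<in> cube ?I \<longrightarrow> f x = f0 x" and f0_sq: "integrable (lebP ?I) (\<lambda>x. (f0 x)\<^sup>2)"
    using square_integrable_representative[OF sqf] by blast
  have intf0: "integrable (lebP ?I) f0"
    by (rule integrable_of_square[OF _ f0 f0_sq]) simp
  have "\<forall>\<tau>\<in>?T. \<exists>g. g \<in> borel_measurable (lebP ?I) \<and> (\<forall>x. x \<notin> cube ?I \<longrightarrow> g x = 0) \<and>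
      (AE x in lebP ?I. x \<in> cube ?I \<longrightarrow> weak_deriv s \<tau> f x = g x) \<and> integrable (lebP ?I) (\<lambda>x. (g x)\<^sup>2)"
  proof
    fix \<tau> assume "\<tau> \<in> ?T"
    then have "square_integrable s (weak_deriv s \<tau> f)" using weak by (auto simp: has_L2_weak_deriv_def)
    then show "\<exists>g. g \<in> borel_measurable (lebP ?I) \<and> (\<forall>x. x \<notin> cube ?I \<longrightarrow> g x = 0) \<and>
      (AE x in lebP ?I. x \<in> cube ?I \<longrightarrow> weak_deriv s \<tau> f x = g x) \<and> integrable (lebP ?I) (\<lambda>x. (g x)\<^sup>2)"
      by (rule square_integrable_representative)
  qed
  then obtain G where "\<forall>\<tau>\<in>?T. G \<tau> \<in> borel_measurable (lebP ?I) \<and> (\<forall>x. x \<notin> cube ?I \<longrightarrow> G \<tau> x = 0) \<and>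
      (AE x in lebP ?I. x \<in> cube ?I \<longrightarrow> weak_deriv s \<tau> f x = G \<tau> x) \<and> integrable (lebP ?I) (\<lambda>x. (G \<tau> x)\<^sup>2)"
    by (rule bchoice[THEN exE])
  then have G: "G \<tau> \<in> borel_measurable (lebP ?I)" "\<And>x. x \<notin> cube ?I \<Longrightarrow> G \<tau> x = 0"
      "AE x in lebP ?I. x \<in> cube ?I \<longrightarrow> weak_deriv s \<tau> f x = G \<tau> x" "integrable (lebP ?I) (\<lambda>x. (G \<tau> x)\<^sup>2)"
    if "\<tau> \<in> ?T" for \<tau>
    using that by blast+
  have intG: "integrable (lebP ?I) (G \<tau>)" if "\<tau> \<in> ?T" for \<tau>
    by (rule integrable_of_square[OF _ G(1)[OF that] G(2)[OF that] G(4)[OF that]]) simp_all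
  have cube_f0: "f0 x * p * indicator (cube ?I) x = f0 x * p" for x p
    using f0(2)[of x] by (auto simp: indicator_def)
  have cube_G: "G \<tau> x * p * indicator (cube ?I) x = G \<tau> x * p" if "\<tau> \<in> ?T" for \<tau> x p
    using G(2)[OF that, of x] by (auto simp: indicator_def)
  have parts: "(\<integral>x. f0 x * tensor s (\<lambda>i. (deriv ^^ \<tau> i) (\<zeta> i)) x \<partial>lebP ?I) =
      (-1) ^ (\<Sum>i=1..s. \<tau> i) * (\<integral>x. G \<tau> x * tensor s \<zeta> x \<partial>lebP ?I)"
    if \<tau>: "\<tau> \<in> ?T" and \<zeta>: "\<And>i. test1 (\<zeta> i)" for \<tau> \<zeta>
  proof -
    have m1: "tensor s (\<lambda>i. (deriv ^^ \<tau> i) (\<zeta> i)) \<in> borel_measurable (lebP ?I)"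
      by (rule tensor_measurable[OF test1_higher_deriv[OF \<zeta>]])
    have m2: "tensor s \<zeta> \<in> borel_measurable (lebP ?I)"
      by (rule tensor_measurable[OF \<zeta>])
    have "test_function s (tensor s \<zeta>)" by (rule test_function_tensor[OF \<zeta>])
    then have "(LINT x:cube ?I|leb ?I. f x * mixed_deriv s \<tau> (tensor s \<zeta>) x) =
        (-1) ^ (\<Sum>i=1..s. \<tau> i) * (LINT x:cube ?I|leb ?I. weak_deriv s \<tau> f x * tensor s \<zeta> x)"
      using weak[OF \<tau>] unfolding has_L2_weak_deriv_def by blast
    also have "mixed_deriv s \<tau> (tensor s \<zeta>) = tensor s (\<lambda>i. (deriv ^^ \<tau> i) (\<zeta> i))"
      by (intro mixed_deriv_tensor test1_smooth \<zeta>)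
    also have "(LINT x:cube ?I|leb ?I. f x * tensor s (\<lambda>i. (deriv ^^ \<tau> i) (\<zeta> i)) x) =
        (\<integral>x. f0 x * tensor s (\<lambda>i. (deriv ^^ \<tau> i) (\<zeta> i)) x \<partial>lebP ?I)"
      by (subst set_integral_representative[OF f0(1) m1 sets_cube f0_ae])
         (simp_all only: cube_f0 subset_refl finite_atLeastAtMost)
    also have "(LINT x:cube ?I|leb ?I. weak_deriv s \<tau> f x * tensor s \<zeta> x) =
        (\<integral>x. G \<tau> x * tensor s \<zeta> x \<partial>lebP ?I)"
      by (subst set_integral_representative[OF G(1)[OF \<tau>] m2 sets_cube G(3)[OF \<tau>]])
         (simp_all only: cube_G[OF \<tau>] subset_refl finite_atLeastAtMost)
    finally show ?thesis .
  qed
  define L where "L k = (\<integral>z. f0 z * (\<Prod>i\<in>?I. bump (a i) (b i) k (z i)) \<partial>lebP ?I)" for k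
  \<comment> \<open>The error made by replacing \<open>\<eta>\<close> by 1 in the coordinates outside \<open>u\<close>.\<close>
  define R where "R \<tau> k = (\<integral>z. \<bar>G \<tau> z\<bar> * \<bar>(\<Prod>i\<in>?I - ?u \<tau>. bump 0 1 k (z i)) -
      (\<Prod>i\<in>?I - ?u \<tau>. indicator {0..<1} (z i))\<bar> \<partial>lebP ?I)" for \<tau> k
  have term_bound: "\<bar>\<integral>x. G \<tau> x * tensor s (\<lambda>i. if \<tau> i = n then \<psi> i else bump 0 1 k) x \<partial>lebP ?I\<bar>
      \<le> ?M * (sobolev_term s n f \<tau> + R \<tau> k)"
    if \<tau>: "\<tau> \<in> ?T" and \<psi>: "\<And>i. test1 (\<psi> i)" "\<And>i x. \<bar>\<psi> i x\<bar> \<le> 5 ^ n" for \<tau> \<psi> k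
  proof -
    define u where "u = ?u \<tau>"
    define \<Psi> where "\<Psi> x = (\<Prod>i\<in>u. \<psi> i (x i))" for x :: "nat \<Rightarrow> real"
    let ?E = "\<lambda>z. \<Prod>i\<in>?I - u. bump 0 1 k (z i)" and ?V = "\<lambda>z. \<Prod>i\<in>?I - u. indicator {0..<1} (z i) :: real"
    have u: "u \<subseteq> ?I" "finite u" "u \<union> (?I - u) = ?I" by (auto simp: u_def)
    have cardu: "card u \<le> s" using card_mono[OF _ u(1)] by simp
    have \<Psi>M: "\<bar>\<Psi> x\<bar> \<le> ?M" for x
      unfolding \<Psi>_def using \<psi>(2) cardu by (intro abs_prod_le_power) auto
    have \<Psi>_restrict: "\<Psi> (restrict z u) = \<Psi> z" for z
      unfolding \<Psi>_def by (rule prod.cong) auto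
    have split: "tensor s (\<lambda>i. if \<tau> i = n then \<psi> i else bump 0 1 k) z = \<Psi> z * ?E z" for z
    proof -
      have "(\<Prod>i\<in>u. (if \<tau> i = n then \<psi> i else bump 0 1 k) (z i)) = \<Psi> z"
        unfolding \<Psi>_def by (rule prod.cong) (auto simp: u_def)
      moreover have "(\<Prod>i\<in>?I - u. (if \<tau> i = n then \<psi> i else bump 0 1 k) (z i)) = ?E z"
        by (rule prod.cong) (auto simp: u_def)
      ultimately show ?thesis
        unfolding tensor_def by (subst prod.subset_diff[OF u(1)]) (auto simp: mult.commute)
    qed
    \<comment> \<open>On the support of \<open>G \<tau>\<close> the function \<open>?V\<close> is the constant 1.\<close>
    have GV: "G \<tau> z * ?V z = G \<tau> z" if "z \<in> space (lebP ?I)" for z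
    proof (cases "z \<in> cube ?I")
      case True
      then have "?V z = (\<Prod>i\<in>?I - u. 1)" by (intro prod.cong) (auto simp: cube_def PiE_iff)
      then show ?thesis by simp
    qed (simp add: G(2)[OF \<tau>])
    have m\<Psi>[measurable]: "\<Psi> \<in> borel_measurable (lebP ?I)" "\<Psi> \<in> borel_measurable (lebP u)"
      unfolding \<Psi>_def[abs_def] using u(1) \<psi>(1)
      by (auto intro!: measurable_prod_coordinates test1_measurable)
    have mE[measurable]: "?E \<in> borel_measurable (lebP ?I)"
      by (intro measurable_prod_coordinates test1_measurable test1_bump) auto
    have mV[measurable]: "?V \<in> borel_measurable (lebP ?I)"
      by (intro measurable_prod_coordinates) auto
    have EV: "\<bar>?E z - ?V z\<bar> \<le> 2" for z
    proof -
      have "\<bar>?E z\<bar> \<le> 1" "\<bar>?V z\<bar> \<le> 1"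
        using bump_bounds by (auto simp: abs_prod intro!: prod_le_1)
      then show ?thesis by linarith
    qed
    have i1: "integrable (lebP ?I) (\<lambda>z. G \<tau> z * \<Psi> z)"
      by (rule integrable_mult_bounded[OF intG[OF \<tau>] m\<Psi>(1) \<Psi>M])
    have i2: "integrable (lebP ?I) (\<lambda>z. G \<tau> z * \<Psi> z * (?E z - ?V z))"
      by (rule integrable_mult_bounded[OF i1 _ EV]) measurable
    have i3: "integrable (lebP ?I) (\<lambda>z. \<bar>G \<tau> z\<bar> * \<bar>?E z - ?V z\<bar>)"
    proof (rule integrable_mult_bounded[where c = 2])
      show "(\<lambda>z. \<bar>?E z - ?V z\<bar>) \<in> borel_measurable (lebP ?I)" by measurable
      show "\<bar>\<bar>?E z - ?V z\<bar>\<bar> \<le> 2" for z using EV[of z] by linarith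
    qed (rule integrable_abs[OF intG[OF \<tau>]])
    have "(\<integral>x. G \<tau> x * tensor s (\<lambda>i. if \<tau> i = n then \<psi> i else bump 0 1 k) x \<partial>lebP ?I) =
        (\<integral>z. G \<tau> z * \<Psi> z + G \<tau> z * \<Psi> z * (?E z - ?V z) \<partial>lebP ?I)"
    proof (rule Bochner_Integration.integral_cong[OF refl])
      fix z assume "z \<in> space (lebP ?I)"
      from GV[OF this] have "G \<tau> z * \<Psi> z = \<Psi> z * (G \<tau> z * ?V z)"
        by (simp only: mult.commute)
      then show "G \<tau> z * tensor s (\<lambda>i. if \<tau> i = n then \<psi> i else bump 0 1 k) z =
          G \<tau> z * \<Psi> z + G \<tau> z * \<Psi> z * (?E z - ?V z)"
        unfolding split by (simp add: algebra_simps)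
    qed
    also have "\<dots> = (\<integral>z. G \<tau> z * \<Psi> z \<partial>lebP ?I) + (\<integral>z. G \<tau> z * \<Psi> z * (?E z - ?V z) \<partial>lebP ?I)"
      by (rule Bochner_Integration.integral_add[OF i1 i2])
    finally have eq: "(\<integral>x. G \<tau> x * tensor s (\<lambda>i. if \<tau> i = n then \<psi> i else bump 0 1 k) x \<partial>lebP ?I) =
        (\<integral>z. G \<tau> z * \<Psi> z \<partial>lebP ?I) + (\<integral>z. G \<tau> z * \<Psi> z * (?E z - ?V z) \<partial>lebP ?I)" .
    have "\<bar>\<integral>z. G \<tau> z * \<Psi> (restrict z u) \<partial>lebP (u \<union> (?I - u))\<bar> \<le> ?M * sqrt (LINT x:cube u|leb u.
        \<bar>LINT y:cube (?I - u)|leb (?I - u). weak_deriv s \<tau> f (merge u (?I - u) (x, y))\<bar>\<^sup>2)"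
      by (rule marginal_bound) (use u G[OF \<tau>] m\<Psi> \<Psi>M in \<open>simp_all only: u(3), auto\<close>)
    then have b1: "\<bar>\<integral>z. G \<tau> z * \<Psi> z \<partial>lebP ?I\<bar> \<le> ?M * sobolev_term s n f \<tau>"
      unfolding \<Psi>_restrict u(3) sobolev_term_def Let_def u_def[symmetric] .
    have "\<bar>\<integral>z. G \<tau> z * \<Psi> z * (?E z - ?V z) \<partial>lebP ?I\<bar> \<le> (\<integral>z. \<bar>G \<tau> z * \<Psi> z * (?E z - ?V z)\<bar> \<partial>lebP ?I)"
      by (rule integral_abs_bound)
    also have "\<dots> \<le> (\<integral>z. ?M * (\<bar>G \<tau> z\<bar> * \<bar>?E z - ?V z\<bar>) \<partial>lebP ?I)"
    proof (rule integral_mono)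
      show "\<bar>G \<tau> z * \<Psi> z * (?E z - ?V z)\<bar> \<le> ?M * (\<bar>G \<tau> z\<bar> * \<bar>?E z - ?V z\<bar>)" for z
        using mult_right_mono[OF \<Psi>M[of z], of "\<bar>G \<tau> z\<bar> * \<bar>?E z - ?V z\<bar>"] by (simp add: abs_mult mult_ac)
    qed (use i2 i3 in auto)
    also have "\<dots> = ?M * R \<tau> k"
      unfolding R_def u_def by (rule integral_mult_right_zero)
    finally show ?thesis
      unfolding eq using b1 by (simp add: distrib_left)
  qed
  have L_bound: "\<bar>L k\<bar> \<le> (\<Sum>\<tau>\<in>?T. ?M * (?M * (sobolev_term s n f \<tau> + R \<tau> k)))" if "k \<ge> 19" for k
  proof -
    have "\<exists>d \<psi>. (\<forall>i. test1 (\<psi> i)) \<and> (\<forall>i x. \<bar>\<psi> i x\<bar> \<le> 5 ^ n) \<and> (\<forall>i m. \<bar>d i m\<bar> \<le> 5 ^ n) \<and>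
      (\<forall>x. tensor s (\<lambda>i. bump (a i) (b i) k) x = (\<Sum>\<tau>\<in>?T. (\<Prod>i\<in>?I. d i (\<tau> i)) *
        tensor s (\<lambda>i. (deriv ^^ \<tau> i) (if \<tau> i = n then \<psi> i else bump 0 1 k)) x))"
      using ab bump_bounds broad_bump[OF that] by (intro tensor_expand test1_bump) auto
    then obtain d \<psi> where \<psi>: "\<And>i. test1 (\<psi> i)" "\<And>i x. \<bar>\<psi> i x\<bar> \<le> 5 ^ n" and d: "\<And>i m. \<bar>d i m\<bar> \<le> (5::real) ^ n"
      and expand: "\<And>x. tensor s (\<lambda>i. bump (a i) (b i) k) x = (\<Sum>\<tau>\<in>?T. (\<Prod>i\<in>?I. d i (\<tau> i)) *
        tensor s (\<lambda>i. (deriv ^^ \<tau> i) (if \<tau> i = n then \<psi> i else bump 0 1 k)) x)"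
      by blast
    let ?\<zeta> = "\<lambda>\<tau> i. if \<tau> i = n then \<psi> i else bump 0 1 k"
    have \<zeta>: "test1 (?\<zeta> \<tau> i)" for \<tau> i using \<psi>(1) by (auto intro: test1_bump)
    have int: "integrable (lebP ?I) (\<lambda>x. f0 x * tensor s (\<lambda>i. (deriv ^^ \<tau> i) (?\<zeta> \<tau> i)) x)" for \<tau>
    proof -
      have t: "\<And>i. test1 ((deriv ^^ \<tau> i) (?\<zeta> \<tau> i))" by (rule test1_higher_deriv[OF \<zeta>])
      then obtain c where "\<And>x. \<bar>tensor s (\<lambda>i. (deriv ^^ \<tau> i) (?\<zeta> \<tau> i)) x\<bar> \<le> c"
        using tensor_bounded[of "\<lambda>i. (deriv ^^ \<tau> i) (?\<zeta> \<tau> i)"] by blast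
      then show ?thesis
        by (rule integrable_mult_bounded[OF intf0 tensor_measurable[OF t]])
    qed
    have L1: "L k = (\<integral>x. (\<Sum>\<tau>\<in>?T. (\<Prod>i\<in>?I. d i (\<tau> i)) *
        (f0 x * tensor s (\<lambda>i. (deriv ^^ \<tau> i) (?\<zeta> \<tau> i)) x)) \<partial>lebP ?I)"
      unfolding L_def using expand by (simp add: tensor_def sum_distrib_left mult_ac)
    have L2: "L k = (\<Sum>\<tau>\<in>?T. (\<Prod>i\<in>?I. d i (\<tau> i)) *
        (\<integral>x. f0 x * tensor s (\<lambda>i. (deriv ^^ \<tau> i) (?\<zeta> \<tau> i)) x \<partial>lebP ?I))"
      unfolding L1 using int by (subst Bochner_Integration.integral_sum) auto
    show ?thesis
      unfolding L2 
    proof (rule order_trans[OF sum_abs sum_mono])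
      fix \<tau> assume \<tau>: "\<tau> \<in> ?T"
      have "\<bar>\<Prod>i\<in>?I. d i (\<tau> i)\<bar> \<le> ?M"
        using d by (intro abs_prod_le_power) auto
      moreover have "\<bar>\<integral>x. f0 x * tensor s (\<lambda>i. (deriv ^^ \<tau> i) (?\<zeta> \<tau> i)) x \<partial>lebP ?I\<bar>
          \<le> ?M * (sobolev_term s n f \<tau> + R \<tau> k)"
        using term_bound[where \<tau> = \<tau> and \<psi> = \<psi> and k = k, OF \<tau> \<psi>]
          unfolding parts[where \<tau> = \<tau> and \<zeta> = "?\<zeta> \<tau>", OF \<tau> \<zeta>[of \<tau>]] by (simp add: abs_mult power_abs)
      ultimately show "\<bar>(\<Prod>i\<in>?I. d i (\<tau> i)) * (\<integral>x. f0 x * tensor s (\<lambda>i. (deriv ^^ \<tau> i) (?\<zeta> \<tau> i)) x \<partial>lebP ?I)\<bar>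
          \<le> ?M * (?M * (sobolev_term s n f \<tau> + R \<tau> k))"
        unfolding abs_mult by (intro mult_mono) auto
    qed
  qed
  have eq: "(\<integral>z. f0 z * (\<Prod>i\<in>?I. indicator {a i..<b i} (z i)) \<partial>lebP ?I) = (LINT x:?B|leb ?I. f x)"
  proof -
    have sets: "?B \<in> sets (lebP ?I)" by (rule sets_PiM_I_finite) auto
    have sub: "?B \<subseteq> cube ?I"
      unfolding cube_def
    proof (rule PiE_mono)
      show "{a i..<b i} \<subseteq> {0..<1}" for i using ab(1)[of i] ab(2)[of i] by auto
    qed
    have "(LINT x:?B|leb ?I. f x * 1) = (\<integral>x. f0 x * 1 * indicator ?B x \<partial>lebP ?I)"
      by (rule set_integral_representative[OF f0(1) _ sets f0_ae sub]) simp
    also have "\<dots> = (\<integral>z. f0 z * (\<Prod>i\<in>?I. indicator {a i..<b i} (z i)) \<partial>lebP ?I)"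
    proof (rule Bochner_Integration.integral_cong[OF refl])
      fix z assume z: "z \<in> space (lebP ?I)"
      have "(\<Prod>i\<in>?I. indicator {a i..<b i} (z i)) = (indicator ?B z :: real)"
      proof (cases "z \<in> ?B")
        case True
        then show ?thesis by (subst prod.neutral) (auto simp: PiE_iff)
      next
        case False
        with z obtain i where "i \<in> ?I" "z i \<notin> {a i..<b i}" by (auto simp: space_PiM PiE_iff)
        then have "(\<Prod>i\<in>?I. indicator {a i..<b i} (z i) :: real) = 0"
          by (intro prod_zero) (auto intro!: bexI[of _ i])
        with False show ?thesis by simp
      qed
      then show "f0 z * 1 * indicator ?B z = f0 z * (\<Prod>i\<in>?I. indicator {a i..<b i} (z i))" by simp
    qed
    finally show ?thesis by simp
  qed
  have "(\<lambda>k. L k) \<longlonglongrightarrow> (\<integral>z. f0 z * (\<Prod>i\<in>?I. indicator {a i..<b i} (z i)) \<partial>lebP ?I)"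
    unfolding L_def by (rule bump_product_integral_tendsto(1)[OF _ intf0 subset_refl ab]) simp
  then have "(\<lambda>k. \<bar>L k\<bar>) \<longlonglongrightarrow> \<bar>\<integral>z. f0 z * (\<Prod>i\<in>?I. indicator {a i..<b i} (z i)) \<partial>lebP ?I\<bar>"
    by (rule tendsto_rabs)
  moreover have "(\<lambda>k. \<Sum>\<tau>\<in>?T. ?M * (?M * (sobolev_term s n f \<tau> + R \<tau> k)))
      \<longlonglongrightarrow> (\<Sum>\<tau>\<in>?T. ?M * (?M * (sobolev_term s n f \<tau> + 0)))"
  proof (intro tendsto_intros)
    fix \<tau> assume "\<tau> \<in> ?T"
    then have "integrable (lebP ?I) (G \<tau>)" by (rule intG)
    then show "R \<tau> \<longlonglongrightarrow> 0"
      unfolding R_def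
      by (rule bump_product_integral_tendsto(2)[OF _ _ Diff_subset, where a = "\<lambda>_. 0" and b = "\<lambda>_. 1", rotated])
         simp_all
  qed
  ultimately have "\<bar>\<integral>z. f0 z * (\<Prod>i\<in>?I. indicator {a i..<b i} (z i)) \<partial>lebP ?I\<bar>
      \<le> (\<Sum>\<tau>\<in>?T. ?M * (?M * (sobolev_term s n f \<tau> + 0)))"
    by (rule LIMSEQ_le) (use L_bound in blast)
  also have "\<dots> \<le> (\<Sum>\<tau>\<in>?T. ?M * (?M * sobolev_norm s n f))"
    using sobolev_term_le by (intro sum_mono mult_left_mono) auto
  also have "\<dots> = real (card ?T) * ?M\<^sup>2 * sobolev_norm s n f"
    by (simp add: power2_eq_square)
  finally show ?thesis by (simp only: eq)
qed

section \<open>Digit expansions\<close>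

lemma floor_mult_power_Suc:
  assumes "b > 0"
  shows "\<lfloor>x * real b ^ Suc m\<rfloor> = int b * \<lfloor>x * real b ^ m\<rfloor> + \<lfloor>x * real b ^ Suc m\<rfloor> mod int b"
proof -
  have "x * real b ^ m = x * real b ^ Suc m / real_of_int (int b)"
    using assms by simp
  then have "\<lfloor>x * real b ^ m\<rfloor> = \<lfloor>x * real b ^ Suc m\<rfloor> div int b"
    by (simp only: floor_divide_real_eq_div[of "int b"] of_nat_0_le_iff)
  then show ?thesis by simp
qed

text \<open>
  Truncating an expansion after \<open>n\<close> digits is rounding down to a multiple of \<open>b^(- n)\<close>.
\<close>

lemma digit_sum_eq_floor:
  assumes b: "b > 0" and x: "0 \<le> x" "x < 1"
    and e: "\<And>j. j \<in> {1..n} \<Longrightarrow> e j = \<lfloor>x * real b ^ j\<rfloor> mod int b"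
  shows "(\<Sum>j=1..n. real_of_int (e j) / real b ^ j) = real_of_int \<lfloor>x * real b ^ n\<rfloor> / real b ^ n"
  using e
proof (induction n)
  case 0
  then show ?case using x by (simp add: floor_unique)
next
  case (Suc n)
  have "(\<Sum>j=1..Suc n. real_of_int (e j) / real b ^ j) =
      real_of_int \<lfloor>x * real b ^ n\<rfloor> / real b ^ n + real_of_int (\<lfloor>x * real b ^ Suc n\<rfloor> mod int b) / real b ^ Suc n"
    using Suc by simp
  also have "\<dots> = real_of_int (int b * \<lfloor>x * real b ^ n\<rfloor> + \<lfloor>x * real b ^ Suc n\<rfloor> mod int b) / real b ^ Suc n"
    using b by (simp add: field_simps)
  finally show ?case by (simp only: floor_mult_power_Suc[OF b, of x n, symmetric])
qed

text \<open>
  As digits are at most \<open>b - 1\<close>, the interval of length \<open>b^(- n - 1)\<close> lies inside the one of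
  length \<open>b^(- n)\<close> given by the first \<open>n\<close> digits. So by induction these are determined by \<open>x\<close>, and
  the last digit is the rest of \<open>\<lfloor>x b^(n + 1)\<rfloor>\<close> modulo \<open>b\<close>.
\<close>

lemma digits_unique:
  assumes b: "b > 0" and x: "0 \<le> x" "x < 1"
    and e: "\<And>j. j \<in> {1..n} \<Longrightarrow> 0 \<le> e j \<and> e j < int b"
    and le: "(\<Sum>j=1..n. real_of_int (e j) / real b ^ j) \<le> x"
    and less: "x < (\<Sum>j=1..n. real_of_int (e j) / real b ^ j) + 1 / real b ^ n"
  shows "\<forall>j\<in>{1..n}. e j = \<lfloor>x * real b ^ j\<rfloor> mod int b"
  using e le less
proof (induction n)
  case (Suc n)
  let ?D = "\<lambda>n. \<Sum>j=1..n. real_of_int (e j) / real b ^ j"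
  have eS: "0 \<le> e (Suc n)" "e (Suc n) < int b" using Suc.prems(1)[of "Suc n"] by auto
  then have "real_of_int (e (Suc n)) + 1 \<le> real b" by linarith
  then have "(real_of_int (e (Suc n)) + 1) / real b ^ Suc n \<le> real b / real b ^ Suc n"
    using b by (intro divide_right_mono) auto
  then have step: "real_of_int (e (Suc n)) / real b ^ Suc n + 1 / real b ^ Suc n \<le> 1 / real b ^ n"
    using b by (simp add: add_divide_distrib)
  have eS0: "0 \<le> real_of_int (e (Suc n)) / real b ^ Suc n" using eS by simp
  have IH: "\<forall>j\<in>{1..n}. e j = \<lfloor>x * real b ^ j\<rfloor> mod int b"
  proof (intro Suc.IH)
    have DS: "?D (Suc n) = ?D n + real_of_int (e (Suc n)) / real b ^ Suc n" by simp
    show "?D n \<le> x" using Suc.prems(2) eS0 unfolding DS by linarith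
    show "x < ?D n + 1 / real b ^ n" using Suc.prems(3) step unfolding DS by linarith
  qed (use Suc.prems(1) in auto)
  then have D: "?D n = real_of_int \<lfloor>x * real b ^ n\<rfloor> / real b ^ n"
    using b x by (intro digit_sum_eq_floor) auto
  have "\<lfloor>x * real b ^ Suc n\<rfloor> = int b * \<lfloor>x * real b ^ n\<rfloor> + e (Suc n)"
  proof (rule floor_unique)
    have DS: "?D (Suc n) * real b ^ Suc n = of_int (int b * \<lfloor>x * real b ^ n\<rfloor> + e (Suc n))"
    proof -
      have "?D (Suc n) * real b ^ Suc n = (?D n * real b ^ n) * real b + real_of_int (e (Suc n))"
        using b by (simp add: distrib_right)
      also have "?D n * real b ^ n = real_of_int \<lfloor>x * real b ^ n\<rfloor>"
        unfolding D using b by simp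
      finally show ?thesis by (simp add: mult.commute)
    qed
    have "?D (Suc n) * real b ^ Suc n \<le> x * real b ^ Suc n"
      using Suc.prems(2) by (intro mult_right_mono) auto
    then show "of_int (int b * \<lfloor>x * real b ^ n\<rfloor> + e (Suc n)) \<le> x * real b ^ Suc n"
      by (simp only: DS)
    have "x * real b ^ Suc n < (?D (Suc n) + 1 / real b ^ Suc n) * real b ^ Suc n"
      using Suc.prems(3) b by (intro mult_strict_right_mono) auto
    then show "x * real b ^ Suc n < of_int (int b * \<lfloor>x * real b ^ n\<rfloor> + e (Suc n)) + 1"
      using b by (simp only: distrib_right DS) simp
  qed
  then have "e (Suc n) = \<lfloor>x * real b ^ Suc n\<rfloor> mod int b" using eS by simp
  with IH show ?case by (auto simp: le_Suc_eq)
qed simp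

lemma mem_digit_interval_iff:
  assumes b: "b > 0" and x: "0 \<le> x" "x < 1"
    and e: "\<And>j. j \<in> {1..n} \<Longrightarrow> 0 \<le> e j \<and> e j < int b"
  shows "x \<in> {(\<Sum>j=1..n. real_of_int (e j) / real b ^ j) ..<
      (\<Sum>j=1..n. real_of_int (e j) / real b ^ j) + 1 / real b ^ n} \<longleftrightarrow>
    (\<forall>j\<in>{1..n}. e j = \<lfloor>x * real b ^ j\<rfloor> mod int b)"
proof
  assume "\<forall>j\<in>{1..n}. e j = \<lfloor>x * real b ^ j\<rfloor> mod int b"
  then have D: "(\<Sum>j=1..n. real_of_int (e j) / real b ^ j) = real_of_int \<lfloor>x * real b ^ n\<rfloor> / real b ^ n"
    using b x by (intro digit_sum_eq_floor) auto
  have "real_of_int \<lfloor>x * real b ^ n\<rfloor> \<le> x * real b ^ n" "x * real b ^ n < real_of_int \<lfloor>x * real b ^ n\<rfloor> + 1"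
    by linarith+
  then show "x \<in> {(\<Sum>j=1..n. real_of_int (e j) / real b ^ j) ..<
      (\<Sum>j=1..n. real_of_int (e j) / real b ^ j) + 1 / real b ^ n}"
    unfolding D using b by (simp add: field_simps)
next
  assume *: "x \<in> {(\<Sum>j=1..n. real_of_int (e j) / real b ^ j) ..<
      (\<Sum>j=1..n. real_of_int (e j) / real b ^ j) + 1 / real b ^ n}"
  show "\<forall>j\<in>{1..n}. e j = \<lfloor>x * real b ^ j\<rfloor> mod int b"
    using * unfolding atLeastLessThan_iff by (elim conjE) (rule digits_unique[OF b x e])
qed

lemma digit_sum_bound:
  assumes b: "b > 0" and e: "\<And>j. j \<in> {1..n} \<Longrightarrow> 0 \<le> e j \<and> e j < int b"
  shows "(\<Sum>j=1..n. real_of_int (e j) / real b ^ j) + 1 / real b ^ n \<le> 1"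
  using e
proof (induction n)
  case (Suc n)
  have "e (Suc n) < int b" using Suc.prems[of "Suc n"] by auto
  then have "real_of_int (e (Suc n)) + 1 \<le> real b" by linarith
  then have "(real_of_int (e (Suc n)) + 1) / real b ^ Suc n \<le> real b / real b ^ Suc n"
    using b by (intro divide_right_mono) auto
  then have "real_of_int (e (Suc n)) / real b ^ Suc n + 1 / real b ^ Suc n \<le> 1 / real b ^ n"
    using b by (simp add: add_divide_distrib)
  then show ?case using Suc by (simp add: Suc.IH)
qed simp

section \<open>Characters of the matrix group\<close>

lemma carrier_mat_group:
  "b > 0 \<Longrightarrow> carrier (mat_group b s n) = ({1..s} \<times> {1..n}) \<rightarrow>\<^sub>E {0..<int b}"
  by (simp add: mat_group_def carrier_integer_mod_group)

lemma finite_carrier_mat_group: "b > 0 \<Longrightarrow> finite (carrier (mat_group b s n))"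
  by (simp add: carrier_mat_group finite_PiE)

lemma card_carrier_mat_group: "b > 0 \<Longrightarrow> card (carrier (mat_group b s n)) = b ^ (s * n)"
  by (simp add: carrier_mat_group card_PiE)

lemma group_mat_group: "group (mat_group b s n)"
  by (simp add: mat_group_def)

lemma omega_nonzero: "omega b \<noteq> 0"
  by (simp add: omega_def)

lemma omega_power_eq_1_iff:
  assumes "b > 0" shows "omega b ^ j = 1 \<longleftrightarrow> b dvd j"
proof -
  have "omega b ^ j = exp (2 * of_real pi * \<i> * of_nat j / of_nat b)"
    unfolding omega_def exp_of_nat_mult[symmetric] by (simp add: mult_ac)
  then show ?thesis
    using complex_root_unity_eq_1[of b j] assms by simp
qed

lemma omega_powi_mod:
  assumes "b > 0" shows "omega b powi (a * (c mod int b)) = omega b powi (a * c)"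
proof -
  have "a * c = a * (c mod int b) + int b * (a * (c div int b))"
    by (metis distrib_left mod_mult_div_eq mult.left_commute)
  moreover have "omega b powi (int b * (a * (c div int b))) = 1"
    using omega_power_eq_1_iff[OF assms, of b] by (simp add: power_int_mult)
  ultimately show ?thesis
    by (simp add: power_int_add omega_nonzero)
qed

lemma mat_pairing_commute: "mat_pairing b s n A B = mat_pairing b s n B A"
  by (simp add: mat_pairing_def mult.commute)

lemma mat_pairing_mult:
  assumes "b > 0"
  shows "mat_pairing b s n A (B \<otimes>\<^bsub>mat_group b s n\<^esub> C) = mat_pairing b s n A B * mat_pairing b s n A C"
proof -
  have "omega b powi (A (i, j) * (B \<otimes>\<^bsub>mat_group b s n\<^esub> C) (i, j)) =
      omega b powi (A (i, j) * B (i, j)) * omega b powi (A (i, j) * C (i, j))"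
    if "i \<in> {1..s}" "j \<in> {1..n}" for i j
    using that assms by (simp add: mat_group_def omega_powi_mod distrib_left power_int_add omega_nonzero)
  then show ?thesis
    unfolding mat_pairing_def prod.distrib[symmetric] by (intro prod.cong) auto
qed

lemma mat_pairing_one: "mat_pairing b s n A \<one>\<^bsub>mat_group b s n\<^esub> = 1"
proof -
  have "\<one>\<^bsub>mat_group b s n\<^esub> (i, j) = 0" if "i \<in> {1..s}" "j \<in> {1..n}" for i j
    using that by (simp add: mat_group_def)
  then show ?thesis unfolding mat_pairing_def by (intro prod.neutral ballI) auto
qed

text \<open>
  Orthogonality: if \<open>A \<bullet> B\<^sub>0 \<noteq> 1\<close>, translating the summation by \<open>B\<^sub>0\<close> multiplies the sum by this
  number without changing it.
\<close>

lemma sum_mat_pairing_subgroup: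
  assumes b: "b > 0" and P: "subgroup P (mat_group b s n)"
  shows "(\<Sum>B\<in>P. mat_pairing b s n A B) = (if \<forall>B\<in>P. mat_pairing b s n A B = 1 then of_nat (card P) else 0)"
proof (cases "\<forall>B\<in>P. mat_pairing b s n A B = 1")
  case False
  then obtain B0 where B0: "B0 \<in> P" "mat_pairing b s n A B0 \<noteq> 1" by blast
  interpret group "mat_group b s n" by (rule group_mat_group)
  let ?S = "\<Sum>B\<in>P. mat_pairing b s n A B"
  have bij: "bij_betw (\<lambda>B. B0 \<otimes>\<^bsub>mat_group b s n\<^esub> B) P P"
  proof (rule bij_betw_byWitness[where f' = "\<lambda>B. inv\<^bsub>mat_group b s n\<^esub> B0 \<otimes>\<^bsub>mat_group b s n\<^esub> B"])
    have in_carrier: "B \<in> carrier (mat_group b s n)" if "B \<in> P" for B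
      using subgroup.mem_carrier[OF P that] .
    show "\<forall>B\<in>P. inv\<^bsub>mat_group b s n\<^esub> B0 \<otimes>\<^bsub>mat_group b s n\<^esub> (B0 \<otimes>\<^bsub>mat_group b s n\<^esub> B) = B"
      using in_carrier B0(1) by (simp add: m_assoc[symmetric])
    show "\<forall>B\<in>P. B0 \<otimes>\<^bsub>mat_group b s n\<^esub> (inv\<^bsub>mat_group b s n\<^esub> B0 \<otimes>\<^bsub>mat_group b s n\<^esub> B) = B"
      using in_carrier B0(1) by (simp add: m_assoc[symmetric])
  qed (use B0(1) subgroup.m_closed[OF P] subgroup.m_inv_closed[OF P] in auto)
  have "?S = (\<Sum>B\<in>P. mat_pairing b s n A (B0 \<otimes>\<^bsub>mat_group b s n\<^esub> B))"
    using sum.reindex_bij_betw[OF bij, of "mat_pairing b s n A"] by simp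
  also have "\<dots> = mat_pairing b s n A B0 * ?S"
    by (simp add: mat_pairing_mult[OF b] sum_distrib_left)
  finally have "(mat_pairing b s n A B0 - 1) * ?S = 0" by (simp add: algebra_simps)
  then have "?S = 0" using B0(2) by simp
  then show ?thesis by (simp only: False if_False)
qed simp

text \<open>
  Pair with the matrix that has a single entry 1, placed where \<open>B\<close> does not vanish.
\<close>

lemma mat_pairing_nondegenerate:
  assumes b: "b \<ge> 2" and B: "B \<in> carrier (mat_group b s n)" "B \<noteq> \<one>\<^bsub>mat_group b s n\<^esub>"
  shows "\<exists>A\<in>carrier (mat_group b s n). mat_pairing b s n B A \<noteq> 1"
proof -
  let ?I = "{1..s} \<times> {1..n}"
  have Bc: "B \<in> ?I \<rightarrow>\<^sub>E {0..<int b}" using B(1) b by (simp add: carrier_mat_group)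
  have "\<exists>p\<in>?I. B p \<noteq> 0"
  proof (rule ccontr)
    assume "\<not> ?thesis"
    then have "B = (\<lambda>p\<in>?I. 0)" using Bc by (auto simp: fun_eq_iff PiE_iff extensional_def)
    then show False using B(2) by (simp add: mat_group_def)
  qed
  then obtain i j where ij: "i \<in> {1..s}" "j \<in> {1..n}" "B (i, j) \<noteq> 0" by auto
  define A where "A = (\<lambda>p\<in>?I. if p = (i, j) then 1 else 0 :: int)"
  have A: "A \<in> carrier (mat_group b s n)" using b by (auto simp: carrier_mat_group A_def)
  have Bij: "0 < B (i, j)" "B (i, j) < int b"
    using PiE_mem[OF Bc, of "(i, j)"] ij by auto
  have "mat_pairing b s n B A = (\<Prod>k\<in>{1..s}. if k = i then omega b powi B (i, j) else 1)"
    unfolding mat_pairing_def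
  proof (rule prod.cong[OF refl])
    fix k assume k: "k \<in> {1..s}"
    have "(\<Prod>l=1..n. omega b powi (B (k, l) * A (k, l))) =
        (\<Prod>l=1..n. if l = j then (if k = i then omega b powi B (i, j) else 1) else 1)"
      using k by (intro prod.cong) (auto simp: A_def)
    then show "(\<Prod>l=1..n. omega b powi (B (k, l) * A (k, l))) = (if k = i then omega b powi B (i, j) else 1)"
      using ij by simp
  qed
  also have "\<dots> = omega b powi B (i, j)" using ij by simp
  also have "\<dots> = omega b ^ nat (B (i, j))" using Bij by (simp add: power_int_def)
  finally have "mat_pairing b s n B A = 1 \<longleftrightarrow> b dvd nat (B (i, j))"
    using omega_power_eq_1_iff[of b] b by simp
  moreover have "\<not> b dvd nat (B (i, j))" using Bij by (auto dest: dvd_imp_le)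
  ultimately show ?thesis using A by blast
qed

text \<open>
  Double counting of \<open>\<Sum>A. \<Sum>B\<in>P. A \<bullet> B\<close>: summing over \<open>B\<close> first, only \<open>A\<close> in the dual of \<open>P\<close>
  contributes; summing over \<open>A\<close> first, only \<open>B = 1\<close> does.
\<close>

lemma trivial_dual_imp_carrier:
  assumes b: "b \<ge> 2" and P: "subgroup P (mat_group b s n)"
    and triv: "dual_group b s n P - {\<one>\<^bsub>mat_group b s n\<^esub>} = {}"
  shows "P = carrier (mat_group b s n)"
proof -
  let ?G = "mat_group b s n" and ?p = "mat_pairing b s n"
  interpret group ?G by (rule group_mat_group)
  have b0: "b > 0" using b by simp
  have fin: "finite (carrier ?G)" by (rule finite_carrier_mat_group[OF b0])
  have finP: "finite P" using finite_subset[OF subgroup.subset[OF P] fin] .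
  have dual: "(\<forall>B\<in>P. ?p A B = 1) \<longleftrightarrow> A = \<one>\<^bsub>?G\<^esub>" if "A \<in> carrier ?G" for A
    using that triv mat_pairing_one[of b s n] by (auto simp: dual_group_def mat_pairing_commute[of b s n "\<one>\<^bsub>?G\<^esub>"])
  have "of_nat (card P) = (\<Sum>A\<in>carrier ?G. if A = \<one>\<^bsub>?G\<^esub> then of_nat (card P) else (0::complex))"
    using fin by simp
  also have "\<dots> = (\<Sum>A\<in>carrier ?G. \<Sum>B\<in>P. ?p A B)"
    by (intro sum.cong) (simp_all add: sum_mat_pairing_subgroup[OF b0 P] dual)
  also have "\<dots> = (\<Sum>B\<in>P. \<Sum>A\<in>carrier ?G. ?p B A)"
    by (subst sum.swap) (simp add: mat_pairing_commute)
  also have "\<dots> = (\<Sum>B\<in>P. if B = \<one>\<^bsub>?G\<^esub> then of_nat (card (carrier ?G)) else 0)"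
  proof (rule sum.cong[OF refl])
    fix B assume "B \<in> P"
    then have "B \<in> carrier ?G" using subgroup.mem_carrier[OF P] by blast
    then have "(\<forall>A\<in>carrier ?G. ?p B A = 1) \<longleftrightarrow> B = \<one>\<^bsub>?G\<^esub>"
      using mat_pairing_nondegenerate[OF b, of B] mat_pairing_one[of b s n]
      by (auto simp: mat_pairing_commute[of b s n "\<one>\<^bsub>?G\<^esub>"])
    then show "(\<Sum>A\<in>carrier ?G. ?p B A) = (if B = \<one>\<^bsub>?G\<^esub> then of_nat (card (carrier ?G)) else 0)"
      by (simp add: sum_mat_pairing_subgroup[OF b0 subgroup_self])
  qed
  also have "\<dots> = of_nat (card (carrier ?G))"
    using finP subgroup.one_closed[OF P] by simp
  finally have "card P = card (carrier ?G)" by (simp only: of_nat_eq_iff)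
  then show ?thesis using card_subset_eq[OF fin subgroup.subset[OF P]] by simp
qed

section \<open>The quadrature error\<close>

lemma measure_mat_box:
  assumes "b > 0"
  shows "measure (leb {1..s}) (mat_box b s n B) = 1 / real b ^ (s * n)"
proof -
  have "emeasure (leb {1..s}) (mat_box b s n B) = (\<Prod>i\<in>{1..s}. ennreal (1 / real b ^ n))"
    unfolding leb_def mat_box_def by (simp add: sets_PiM_I_finite emeasure_lebP_PiE)
  also have "\<dots> = ennreal (1 / real b ^ (s * n))"
    by (simp add: ennreal_power power_divide power_mult[symmetric] mult.commute)
  finally show ?thesis by (simp add: measure_def)
qed

lemma entries_carrier_mat_group:
  assumes "b > 0" "B \<in> carrier (mat_group b s n)" "i \<in> {1..s}" "j \<in> {1..n}"
  shows "0 \<le> B (i, j) \<and> B (i, j) < int b"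
  using PiE_mem[of B "{1..s} \<times> {1..n}" "\<lambda>_. {0..<int b}" "(i, j)"] assms by (simp add: carrier_mat_group)

lemma mat_point_bounds:
  assumes "b > 0" "B \<in> carrier (mat_group b s n)" "i \<in> {1..s}"
  shows "0 \<le> mat_point b n B i" "mat_point b n B i + 1 / real b ^ n \<le> 1"
proof -
  note e = entries_carrier_mat_group[OF assms]
  show "0 \<le> mat_point b n B i"
    unfolding mat_point_def using e by (intro sum_nonneg) auto
  show "mat_point b n B i + 1 / real b ^ n \<le> 1"
    unfolding mat_point_def by (rule digit_sum_bound[OF assms(1) e])
qed

lemma mat_box_subset_cube:
  assumes "b > 0" "B \<in> carrier (mat_group b s n)"
  shows "mat_box b s n B \<subseteq> cube {1..s}"
  unfolding mat_box_def cube_def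
proof (rule PiE_mono)
  show "{mat_point b n B i..<mat_point b n B i + 1 / real b ^ n} \<subseteq> {0..<1}" if "i \<in> {1..s}" for i
    using mat_point_bounds[OF assms that] by auto
qed

text \<open>
  This is what makes the boxes a partition: the matrix whose box contains \<open>x\<close> exists and is
  unique, its entries being the digits of the coordinates of \<open>x\<close>.
\<close>

lemma mem_mat_box_iff:
  assumes b: "b > 0" and B: "B \<in> carrier (mat_group b s n)" and x: "x \<in> cube {1..s}"
  shows "x \<in> mat_box b s n B \<longleftrightarrow> B = (\<lambda>(i, j)\<in>{1..s} \<times> {1..n}. \<lfloor>x i * real b ^ j\<rfloor> mod int b)"
proof -
  have "x \<in> mat_box b s n B \<longleftrightarrow>
      (\<forall>i\<in>{1..s}. x i \<in> {mat_point b n B i ..< mat_point b n B i + 1 / real b ^ n})"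
    using x by (simp add: mat_box_def cube_def PiE_iff)
  also have "\<dots> \<longleftrightarrow> (\<forall>i\<in>{1..s}. \<forall>j\<in>{1..n}. B (i, j) = \<lfloor>x i * real b ^ j\<rfloor> mod int b)"
  proof (rule ball_cong[OF refl])
    fix i assume i: "i \<in> {1..s}"
    then have "0 \<le> x i" "x i < 1" using x by (auto simp: cube_def PiE_iff)
    then show "x i \<in> {mat_point b n B i ..< mat_point b n B i + 1 / real b ^ n} \<longleftrightarrow>
        (\<forall>j\<in>{1..n}. B (i, j) = \<lfloor>x i * real b ^ j\<rfloor> mod int b)"
      unfolding mat_point_def
      by (intro mem_digit_interval_iff b entries_carrier_mat_group[OF b B i])
  qed
  also have "\<dots> \<longleftrightarrow> B = (\<lambda>(i, j)\<in>{1..s} \<times> {1..n}. \<lfloor>x i * real b ^ j\<rfloor> mod int b)"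
    using B b by (auto simp: carrier_mat_group fun_eq_iff PiE_iff extensional_def)
  finally show ?thesis .
qed

lemma true_integral_eq_sum_boxes:
  assumes b: "b > 0" and f: "square_integrable s f"
  shows "true_integral s f = (\<Sum>B\<in>carrier (mat_group b s n). LINT x:mat_box b s n B|leb {1..s}. f x)"
proof -
  let ?C = "carrier (mat_group b s n)" and ?I = "{1..s}"
  obtain g where g: "g \<in> borel_measurable (lebP ?I)" "\<And>x. x \<notin> cube ?I \<Longrightarrow> g x = 0"
    "AE x in lebP ?I. x \<in> cube ?I \<longrightarrow> f x = g x" "integrable (lebP ?I) (\<lambda>x. (g x)\<^sup>2)"
    using square_integrable_representative[OF f] by blast
  have intg: "integrable (lebP ?I) g"
    by (rule integrable_of_square[OF _ g(1,2,4)]) simp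
  have fin: "finite ?C" by (rule finite_carrier_mat_group[OF b])
  have box: "mat_box b s n B \<in> sets (lebP ?I)" for B
    unfolding mat_box_def by (rule sets_PiM_I_finite) auto
  have rep: "(LINT x:A|leb ?I. f x) = (\<integral>x. g x * indicator A x \<partial>lebP ?I)"
    if "A \<in> sets (lebP ?I)" "A \<subseteq> cube ?I" for A
    using set_integral_representative[OF g(1) _ that(1) g(3) that(2), of "\<lambda>_. 1"] by simp
  have partition: "indicator (cube ?I) x = (\<Sum>B\<in>?C. indicator (mat_box b s n B) x :: real)" for x
  proof (cases "x \<in> cube ?I")
    case True
    let ?B = "\<lambda>(i, j)\<in>?I \<times> {1..n}. \<lfloor>x i * real b ^ j\<rfloor> mod int b"
    have "?B \<in> ?C" using b by (auto simp: carrier_mat_group)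
    moreover have "(\<Sum>B\<in>?C. indicator (mat_box b s n B) x :: real) = (\<Sum>B\<in>?C. if B = ?B then 1 else 0)"
      using mem_mat_box_iff[OF b _ True] by (intro sum.cong) (auto simp: indicator_def)
    ultimately show ?thesis using True fin by simp
  next
    case False
    then have "x \<notin> mat_box b s n B" if "B \<in> ?C" for B using mat_box_subset_cube[OF b that] by blast
    with False show ?thesis by simp
  qed
  have "true_integral s f = (\<integral>x. g x * indicator (cube ?I) x \<partial>lebP ?I)"
    unfolding true_integral_def by (rule rep[OF sets_cube subset_refl]) simp
  also have "\<dots> = (\<integral>x. (\<Sum>B\<in>?C. g x * indicator (mat_box b s n B) x) \<partial>lebP ?I)"
    by (simp only: partition sum_distrib_left)
  also have "\<dots> = (\<Sum>B\<in>?C. \<integral>x. g x * indicator (mat_box b s n B) x \<partial>lebP ?I)"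
    by (rule Bochner_Integration.integral_sum) (rule integrable_real_mult_indicator[OF box intg])
  also have "\<dots> = (\<Sum>B\<in>?C. LINT x:mat_box b s n B|leb ?I. f x)"
    by (intro sum.cong refl rep[symmetric] box mat_box_subset_cube b)
  finally show ?thesis .
qed

lemma discretization_eq:
  "b > 0 \<Longrightarrow> discretization b s n f B = real b ^ (s * n) * (LINT x:mat_box b s n B|leb {1..s}. f x)"
  unfolding discretization_def by (subst measure_mat_box) auto

lemma Err_carrier:
  assumes b: "b > 0" and f: "square_integrable s f"
  shows "Err b s n f (carrier (mat_group b s n)) = 0"
  using b by (simp add: Err_def discretized_QMC_def discretization_eq true_integral_eq_sum_boxes[OF b f, of n]
      card_carrier_mat_group sum_distrib_left[symmetric])

lemma sobolev_norm_nonneg: "sobolev_norm s n f \<ge> 0"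
  unfolding sobolev_norm_def set_lebesgue_integral_def
  by (intro real_sqrt_ge_zero sum_nonneg Bochner_Integration.integral_nonneg) auto

lemma Err_bound:
  assumes b: "b > 0" and f: "n_smooth s n f" and P: "subgroup P (mat_group b s n)"
  shows "Err b s n f P \<le>
    (1 + real b ^ (s * n)) * (real (card ({1..s} \<rightarrow>\<^sub>E {0..n})) * ((5 ^ n) ^ s)\<^sup>2) * sobolev_norm s n f"
proof -
  let ?K = "real (card ({1..s} \<rightarrow>\<^sub>E {0..n})) * ((5 ^ n) ^ s)\<^sup>2 * sobolev_norm s n f"
  let ?q = "real b ^ (s * n)"
  have "true_integral s f = (LINT x:(\<Pi>\<^sub>E i\<in>{1..s}. {0..<1})|leb {1..s}. f x)"
    by (simp add: true_integral_def cube_def)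
  then have t: "\<bar>true_integral s f\<bar> \<le> ?K"
    using box_integral_bound[OF f, of "\<lambda>_. 0" "\<lambda>_. 1"] by simp
  have d: "\<bar>discretization b s n f B\<bar> \<le> ?q * ?K" if "B \<in> P" for B
  proof -
    let ?a = "\<lambda>i. if i \<in> {1..s} then mat_point b n B i else 0"
    let ?b = "\<lambda>i. if i \<in> {1..s} then mat_point b n B i + 1 / real b ^ n else 1"
    have B: "B \<in> carrier (mat_group b s n)" using that subgroup.mem_carrier[OF P] by blast
    have "mat_box b s n B = (\<Pi>\<^sub>E i\<in>{1..s}. {?a i..<?b i})"
      unfolding mat_box_def by (rule PiE_cong) auto
    then have "\<bar>LINT x:mat_box b s n B|leb {1..s}. f x\<bar> \<le> ?K"
      using box_integral_bound[OF f, of ?a ?b] mat_point_bounds[OF b B] by simp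
    then show ?thesis
      by (simp only: discretization_eq[OF b] abs_mult) (simp add: mult_left_mono)
  qed
  have "finite P" "P \<noteq> {}"
    using finite_subset[OF subgroup.subset[OF P] finite_carrier_mat_group[OF b]] subgroup.one_closed[OF P] by auto
  then have cP: "real (card P) > 0" by (simp add: card_gt_0_iff)
  have "\<bar>\<Sum>B\<in>P. discretization b s n f B\<bar> \<le> real (card P) * (?q * ?K)"
    using d by (intro order_trans[OF sum_abs] sum_bounded_above)
  then have "\<bar>discretized_QMC b s n P f\<bar> \<le> ?q * ?K"
    unfolding discretized_QMC_def abs_mult using cP by (simp add: field_simps)
  with t have "Err b s n f P \<le> ?K + ?q * ?K"
    unfolding Err_def by linarith
  then show ?thesis by (simp add: algebra_simps)
qed

lemma dick_weight_le: "dick_weight s n A \<le> s * n * n"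
proof -
  have "dick_weight s n A \<le> (\<Sum>i=1..s. \<Sum>j=1..n. n)"
    unfolding dick_weight_def by (intro sum_mono) auto
  then show ?thesis by simp
qed

text \<open>
  A crude bound that does not see which \<open>A\<close> lies in the dual; it suffices because the constant may
  depend on \<open>s\<close> and \<open>n\<close>.
\<close>

lemma WF_lower_bound:
  assumes b: "b > 0" and A: "A \<in> dual_group b s n P - {\<one>\<^bsub>mat_group b s n\<^esub>}"
  shows "1 / real b ^ (s * n * n) \<le> WF b s n P"
proof -
  have "finite (dual_group b s n P)"
    using finite_carrier_mat_group[OF b, of s n] by (rule finite_subset[rotated]) (auto simp: dual_group_def)
  have "1 / real b ^ (s * n * n) \<le> 1 / real b ^ dick_weight s n A"
    using b dick_weight_le[of s n A] by (intro divide_left_mono power_increasing) auto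
  also have "\<dots> \<le> WF b s n P"
    unfolding WF_def using A \<open>finite _\<close>
    by (intro member_le_sum[where f = "\<lambda>A. 1 / real b ^ dick_weight s n A"]) auto
  finally show ?thesis .
qed

theorem mainTheorem1:
  fixes b s n :: nat
  assumes "b \<ge> 2" and "s \<ge> 1" and "n \<ge> 1"
  shows "\<exists>C::real. \<forall>(f :: (nat \<Rightarrow> real) \<Rightarrow> real) (P :: (nat \<times> nat \<Rightarrow> int) set).
           n_smooth s n f \<longrightarrow> subgroup P (mat_group b s n) \<longrightarrow>
           Err b s n f P \<le> C * sobolev_norm s n f * WF b s n P"
proof -
  define K where "K = (1 + real b ^ (s * n)) * (real (card ({1..s} \<rightarrow>\<^sub>E {0..n})) * ((5 ^ n) ^ s)\<^sup>2)"
  have b: "b > 0" using assms by simp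
  have K0: "K \<ge> 0" by (simp add: K_def)
  show ?thesis
  proof (intro exI[of _ "K * real b ^ (s * n * n)"] allI impI)
    fix f P assume f: "n_smooth s n f" and P: "subgroup P (mat_group b s n)"
    show "Err b s n f P \<le> K * real b ^ (s * n * n) * sobolev_norm s n f * WF b s n P"
    proof (cases "dual_group b s n P - {\<one>\<^bsub>mat_group b s n\<^esub>} = {}")
      case True
      then have "P = carrier (mat_group b s n)" by (rule trivial_dual_imp_carrier[OF assms(1) P])
      with Err_carrier[OF b n_smooth_imp_square_integrable[OF f]] have "Err b s n f P = 0" by simp
      moreover have "WF b s n P = 0" unfolding WF_def True by simp
      ultimately show ?thesis by simp
    next
      case False
      then obtain A where "A \<in> dual_group b s n P - {\<one>\<^bsub>mat_group b s n\<^esub>}" by blast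
      from WF_lower_bound[OF b this] have "1 \<le> real b ^ (s * n * n) * WF b s n P"
        using b by (simp add: field_simps)
      then have "K * sobolev_norm s n f * 1 \<le> K * sobolev_norm s n f * (real b ^ (s * n * n) * WF b s n P)"
        using K0 sobolev_norm_nonneg by (intro mult_left_mono mult_nonneg_nonneg) auto
      with Err_bound[OF b f P] show ?thesis by (simp add: K_def mult_ac)
    qed
  qed
qed

end
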